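(* Let $r>1$. For each $\beta\in k$, the element $Y-\beta=y^p-y(x^2-2g_1)^{\frac{p-1}{2}}-\beta$ generates a maximal submodule of $\Delta_0$. Therefore the simple $H_{g_1}$-modules over the singular locus are $p$-dimensional over $k$.
   Context: Let $p$ be an odd prime, $q=p^r$, $k=\overline{\mathbb F}_q$, and $E=\left\{\begin{pmatrix}1&a\\0&1\end{pmatrix}: a\in\mathbb F_q\right\}\cong(\mathbb Z/p)^r$. Let $\xi$ generate $\mathbb F_q^\times$ and put $g_i=\begin{pmatrix}1&\xi^{i-1}\\0&1\end{pmatrix}$ for $i=1,\dots,r$, so that $g_1=\begin{pmatrix}1&1\\0&1\end{pmatrix}$ and $g_1,\dots,g_r$ generate $E$. $E$ acts on $k\langle x,y\rangle$ by algebra automorphisms, $\begin{pmatrix}1&a\\0&1\end{pmatrix}$ fixing $x$ and sending $y\mapsto y+ax$; $k\langle x,y\rangle\rtimes E$ is the smash product, and $H_{g_1}=(k\langle x,y\rangle\rtimes E)/(xy-yx-g_1)$. Modules are left modules, and $\Delta_0=H_{g_1}/\bigl(H_{g_1}x+\sum_{i=1}^rH_{g_1}(g_i-1)\bigr)$; "generates a submodule of $\Delta_0$" refers to the image in $\Delta_0$. The center of $H_{g_1}$ is (by the paper) isomorphic to $k[A,B,C]/(A^p-B^2)$ with $B$ corresponding to $x^p$, so its spectrum is singular exactly along the line $A=B=0$; the simple modules over the singular locus are those on which $x^p$ acts by $0$. *)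

theory Defs
  imports
    "HOL-Analysis.Cartesian_Space"
    "HOL-Library.Poly_Mapping"
    "HOL-Computational_Algebra.Polynomial"
    "HOL-Algebra.Module"
    "HOL-Algebra.QuotRing"
begin

section \<open>Finite subfields and algebraic closures\<close>

definition is_subfield :: "'k::field set \<Rightarrow> bool" where
  "is_subfield F \<longleftrightarrow> 0 \<in> F \<and> 1 \<in> F \<and>
     (\<forall>a\<in>F. \<forall>b\<in>F. a + b \<in> F \<and> a * b \<in> F) \<and> (\<forall>a\<in>F. - a \<in> F \<and> inverse a \<in> F)"

definition algebraic_over :: "'k::field set \<Rightarrow> 'k \<Rightarrow> bool" where
  "algebraic_over F z \<longleftrightarrow> (\<exists>f. f \<noteq> 0 \<and> (\<forall>i. poly.coeff f i \<in> F) \<and> poly f z = 0)"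

text \<open>The ambient type is an algebraic closure of its subset \<open>F\<close>; algebraic closedness is
  imposed by the type class.\<close>

definition closure_of_subfield :: "'k::alg_closed_field set \<Rightarrow> bool" where
  "closure_of_subfield F \<longleftrightarrow> is_subfield F \<and> (\<forall>z. algebraic_over F z)"


section \<open>Left modules over noncommutative rings\<close>

text \<open>The locale \<open>module\<close> of HOL-Algebra requires a commutative ring of scalars.\<close>

locale left_module = R?: ring R + M?: abelian_group M for R (structure) and M (structure) +
  assumes smult_closed:
      "\<lbrakk>a \<in> carrier R; x \<in> carrier M\<rbrakk> \<Longrightarrow> a \<odot>\<^bsub>M\<^esub> x \<in> carrier M"
    and smult_l_distr:
      "\<lbrakk>a \<in> carrier R; b \<in> carrier R; x \<in> carrier M\<rbrakk> \<Longrightarrow>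
        (a \<oplus>\<^bsub>R\<^esub> b) \<odot>\<^bsub>M\<^esub> x = a \<odot>\<^bsub>M\<^esub> x \<oplus>\<^bsub>M\<^esub> b \<odot>\<^bsub>M\<^esub> x"
    and smult_r_distr:
      "\<lbrakk>a \<in> carrier R; x \<in> carrier M; y \<in> carrier M\<rbrakk> \<Longrightarrow>
        a \<odot>\<^bsub>M\<^esub> (x \<oplus>\<^bsub>M\<^esub> y) = a \<odot>\<^bsub>M\<^esub> x \<oplus>\<^bsub>M\<^esub> a \<odot>\<^bsub>M\<^esub> y"
    and smult_assoc:
      "\<lbrakk>a \<in> carrier R; b \<in> carrier R; x \<in> carrier M\<rbrakk> \<Longrightarrow>
        (a \<otimes>\<^bsub>R\<^esub> b) \<odot>\<^bsub>M\<^esub> x = a \<odot>\<^bsub>M\<^esub> (b \<odot>\<^bsub>M\<^esub> x)"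
    and smult_one:
      "x \<in> carrier M \<Longrightarrow> \<one>\<^bsub>R\<^esub> \<odot>\<^bsub>M\<^esub> x = x"

definition simple_module :: "('a, 'c) ring_scheme \<Rightarrow> ('a, 'b, 'd) module_scheme \<Rightarrow> bool" where
  "simple_module R M \<longleftrightarrow> left_module R M \<and> carrier M \<noteq> {\<zero>\<^bsub>M\<^esub>} \<and>
     (\<forall>N. submodule N R M \<longrightarrow> N = {\<zero>\<^bsub>M\<^esub>} \<or> N = carrier M)"

definition maximal_submodule ::
  "('a, 'c) ring_scheme \<Rightarrow> ('a, 'b, 'd) module_scheme \<Rightarrow> 'b set \<Rightarrow> bool" where
  "maximal_submodule R M N \<longleftrightarrow> submodule N R M \<and> N \<noteq> carrier M \<and>
     (\<forall>N'. submodule N' R M \<and> N \<subseteq> N' \<longrightarrow> N' = N \<or> N' = carrier M)"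

definition submodule_generated ::
  "('a, 'c) ring_scheme \<Rightarrow> ('a, 'b, 'd) module_scheme \<Rightarrow> 'b set \<Rightarrow> 'b set" where
  "submodule_generated R M S = \<Inter>{N. submodule N R M \<and> S \<subseteq> N}"

text \<open>Modules are HOL-Algebra records, which extend ring records; the multiplicative fields
  carry no information and are left unspecified.\<close>

definition regular_module :: "('a, 'c) ring_scheme \<Rightarrow> ('a, 'a) module" where
  "regular_module R = \<lparr>carrier = carrier R, monoid.mult = undefined, one = undefined,
     zero = \<zero>\<^bsub>R\<^esub>, add = ring.add R, smult = monoid.mult R\<rparr>"

definition quotient_module :: "('a, 'b, 'd) module_scheme \<Rightarrow> 'b set \<Rightarrow> ('a, 'b set) module" where
  "quotient_module M N = \<lparr>carrier = a_rcosets\<^bsub>M\<^esub> N, monoid.mult = undefined, one = undefined,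
     zero = N, add = set_add M, smult = (\<lambda>a C. \<Union>m\<in>C. N +>\<^bsub>M\<^esub> (a \<odot>\<^bsub>M\<^esub> m))\<rparr>"

text \<open>Dimension over a field \<open>'k\<close> acting on \<open>M\<close> through \<open>\<iota> :: 'k \<Rightarrow> R\<close>: there is a basis
  with \<open>n\<close> elements.\<close>

definition has_dimension ::
  "('k::field \<Rightarrow> 'a) \<Rightarrow> ('a, 'b, 'd) module_scheme \<Rightarrow> nat \<Rightarrow> bool" where
  "has_dimension \<iota> M n \<longleftrightarrow> (\<exists>B. B \<subseteq> carrier M \<and> finite B \<and> card B = n \<and>
     (\<forall>m\<in>carrier M. \<exists>!c. c \<in> B \<rightarrow>\<^sub>E UNIV \<and> m = (\<Oplus>\<^bsub>M\<^esub>b\<in>B. \<iota> (c b) \<odot>\<^bsub>M\<^esub> b)))"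


section \<open>Free algebras\<close>

text \<open>The free algebra on \<open>'v\<close> is the monoid algebra of the free monoid: with the monoid
  structure below, \<open>'v list \<Rightarrow>\<^sub>0 'k\<close> carries the convolution product of
  \<^theory>\<open>HOL-Library.Poly_Mapping\<close>.\<close>

instantiation list :: (type) monoid_add
begin

definition zero_list :: "'a list" where "zero_list = []"

definition plus_list :: "'a list \<Rightarrow> 'a list \<Rightarrow> 'a list" where "plus_list u v = u @ v"

instance by standard (simp_all add: zero_list_def plus_list_def)

end

definition free_const :: "'k::field \<Rightarrow> 'v list \<Rightarrow>\<^sub>0 'k" where
  "free_const c = Poly_Mapping.single [] c"

definition free_var :: "'v \<Rightarrow> 'v list \<Rightarrow>\<^sub>0 'k::field" where
  "free_var v = Poly_Mapping.single [v] 1"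

text \<open>The algebra endomorphism with \<open>v \<mapsto> \<sigma> v\<close> for each generator \<open>v\<close>.\<close>

definition free_subst ::
  "('v \<Rightarrow> 'v list \<Rightarrow>\<^sub>0 'k::field) \<Rightarrow> ('v list \<Rightarrow>\<^sub>0 'k) \<Rightarrow> 'v list \<Rightarrow>\<^sub>0 'k" where
  "free_subst \<sigma> f =
     (\<Sum>w\<in>Poly_Mapping.keys f. free_const (Poly_Mapping.lookup f w) * prod_list (map \<sigma> w))"


section \<open>Smash products with finite groups\<close>

text \<open>\<open>f\<close> stands for \<open>\<Sum>g\<in>G. f g \<cdot> g\<close>, and \<open>(a g) (b h) = a (g \<cdot> b) (g h)\<close>. The definition is
  meant for finite \<open>G\<close>, where no support condition is needed.\<close>

definition smash_product ::
  "('g, 'c) monoid_scheme \<Rightarrow> ('g \<Rightarrow> 'a \<Rightarrow> 'a) \<Rightarrow> ('g \<Rightarrow> 'a::ring_1) ring" where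
  "smash_product G \<alpha> = \<lparr>
     carrier = carrier G \<rightarrow>\<^sub>E UNIV,
     monoid.mult = (\<lambda>f h. \<lambda>g\<in>carrier G. \<Sum>u\<in>carrier G. f u * \<alpha> u (h (inv\<^bsub>G\<^esub> u \<otimes>\<^bsub>G\<^esub> g))),
     one = (\<lambda>g\<in>carrier G. if g = \<one>\<^bsub>G\<^esub> then 1 else 0),
     zero = (\<lambda>g\<in>carrier G. 0),
     add = (\<lambda>f h. \<lambda>g\<in>carrier G. f g + h g)\<rparr>"

definition smash_single :: "('g, 'c) monoid_scheme \<Rightarrow> 'a \<Rightarrow> 'g \<Rightarrow> 'g \<Rightarrow> 'a::ring_1" where
  "smash_single G a u = (\<lambda>g\<in>carrier G. if g = u then a else 0)"


section \<open>The algebra $H_{g_1}$\<close>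

datatype gen = GenX | GenY

type_synonym 'k free_alg = "gen list \<Rightarrow>\<^sub>0 'k"
type_synonym 'k smash_elt = "'k^2^2 \<Rightarrow> 'k free_alg"

definition unip :: "'k::field \<Rightarrow> 'k^2^2" where
  "unip a = vector [vector [1, a], vector [0, 1]]"

definition E_group :: "'k::field set \<Rightarrow> ('k^2^2) monoid" where
  "E_group F = \<lparr>carrier = unip ` F, monoid.mult = (**), one = mat 1\<rparr>"

definition E_act :: "'k::field^2^2 \<Rightarrow> 'k free_alg \<Rightarrow> 'k free_alg" where
  "E_act g = free_subst (\<lambda>v. case v of
     GenX \<Rightarrow> free_var GenX
   | GenY \<Rightarrow> free_var GenY + free_const (g $ 1 $ 2) * free_var GenX)"

definition smash :: "'k::field set \<Rightarrow> 'k smash_elt ring" where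
  "smash F = smash_product (E_group F) E_act"

definition of_alg :: "'k::field set \<Rightarrow> 'k free_alg \<Rightarrow> 'k smash_elt" where
  "of_alg F a = smash_single (E_group F) a (mat 1)"

definition of_grp :: "'k::field set \<Rightarrow> 'k^2^2 \<Rightarrow> 'k smash_elt" where
  "of_grp F u = smash_single (E_group F) 1 u"

definition H_relation :: "'k::field set \<Rightarrow> 'k smash_elt" where
  "H_relation F =
     of_alg F (free_var GenX * free_var GenY - free_var GenY * free_var GenX)
       \<ominus>\<^bsub>smash F\<^esub> of_grp F (unip 1)"

definition H_ideal :: "'k::field set \<Rightarrow> 'k smash_elt set" where
  "H_ideal F = Idl\<^bsub>smash F\<^esub> {H_relation F}"

definition H_alg :: "'k::field set \<Rightarrow> 'k smash_elt set ring" where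
  "H_alg F = smash F Quot H_ideal F"

definition x_H :: "'k::field set \<Rightarrow> 'k smash_elt set" where
  "x_H F = H_ideal F +>\<^bsub>smash F\<^esub> of_alg F (free_var GenX)"

definition y_H :: "'k::field set \<Rightarrow> 'k smash_elt set" where
  "y_H F = H_ideal F +>\<^bsub>smash F\<^esub> of_alg F (free_var GenY)"

definition grp_H :: "'k::field set \<Rightarrow> 'k^2^2 \<Rightarrow> 'k smash_elt set" where
  "grp_H F u = H_ideal F +>\<^bsub>smash F\<^esub> of_grp F u"

definition const_H :: "'k::field set \<Rightarrow> 'k \<Rightarrow> 'k smash_elt set" where
  "const_H F c = H_ideal F +>\<^bsub>smash F\<^esub> of_alg F (free_const c)"

definition g_gen :: "'k::field \<Rightarrow> nat \<Rightarrow> 'k^2^2" where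
  "g_gen \<xi> i = unip (\<xi> ^ (i - 1))"


section \<open>The module $\Delta_0$\<close>

definition Delta0_ideal :: "'k::field set \<Rightarrow> nat \<Rightarrow> 'k \<Rightarrow> 'k smash_elt set set" where
  "Delta0_ideal F r \<xi> =
     {(h \<otimes>\<^bsub>H_alg F\<^esub> x_H F) \<oplus>\<^bsub>H_alg F\<^esub>
        (\<Oplus>\<^bsub>H_alg F\<^esub>i\<in>{1..r}. c i \<otimes>\<^bsub>H_alg F\<^esub> (grp_H F (g_gen \<xi> i) \<ominus>\<^bsub>H_alg F\<^esub> \<one>\<^bsub>H_alg F\<^esub>))
      | h c. h \<in> carrier (H_alg F) \<and> c \<in> {1..r} \<rightarrow> carrier (H_alg F)}"

definition Delta0 ::
  "'k::field set \<Rightarrow> nat \<Rightarrow> 'k \<Rightarrow> ('k smash_elt set, 'k smash_elt set set) module" where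
  "Delta0 F r \<xi> = quotient_module (regular_module (H_alg F)) (Delta0_ideal F r \<xi>)"

definition Delta0_class ::
  "'k::field set \<Rightarrow> nat \<Rightarrow> 'k \<Rightarrow> 'k smash_elt set \<Rightarrow> 'k smash_elt set set" where
  "Delta0_class F r \<xi> h = Delta0_ideal F r \<xi> +>\<^bsub>H_alg F\<^esub> h"

definition Y_H :: "'k::field set \<Rightarrow> nat \<Rightarrow> 'k smash_elt set" where
  "Y_H F p =
     (y_H F [^]\<^bsub>H_alg F\<^esub> p) \<ominus>\<^bsub>H_alg F\<^esub>
     (y_H F \<otimes>\<^bsub>H_alg F\<^esub>
       (((x_H F [^]\<^bsub>H_alg F\<^esub> (2::nat)) \<ominus>\<^bsub>H_alg F\<^esub>
         (const_H F 2 \<otimes>\<^bsub>H_alg F\<^esub> grp_H F (unip 1))) [^]\<^bsub>H_alg F\<^esub> ((p - 1) div 2)))"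

text \<open>The singular locus of the spectrum of the center of $H_{g_1}$ is $A = B = 0$, where
  $A^p = B^2$ and $B$ corresponds to $x^p$; a simple module lies over it iff $x^p$ acts by $0$.\<close>

definition over_singular_locus ::
  "'k::field set \<Rightarrow> nat \<Rightarrow> ('k smash_elt set, 'm, 'd) module_scheme \<Rightarrow> bool" where
  "over_singular_locus F p M \<longleftrightarrow>
     (\<forall>m\<in>carrier M. (x_H F [^]\<^bsub>H_alg F\<^esub> p) \<odot>\<^bsub>M\<^esub> m = \<zero>\<^bsub>M\<^esub>)"

end

theory Submission
  imports Defs
begin

text \<open>
  In \<open>H = H_alg F\<close> the commutator with \<open>y\<close> is a derivation of the commutative subalgebra generated by
  \<open>x\<close> and \<open>E\<close>, with \<open>[x, y] = g\<^sub>1\<close> and \<open>[g\<^sub>a, y] = a x g\<^sub>a\<close>. This gives a representation of \<open>H\<close> on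
  \<open>k[y]\<close> with \<open>x 1 = 0\<close> and \<open>g\<^sub>a 1 = 1\<close>, to which \<open>\<Delta>\<^sub>0\<close> is isomorphic. There \<open>x\<^sup>2 - 2 g\<^sub>1\<close> acts as
  \<open>-2\<close>, so \<open>Y - \<beta>\<close> maps the generator \<open>1\<close> to \<open>Q = y\<^sup>p - \<epsilon> y - \<beta>\<close> with \<open>\<epsilon> = (-2)\<^bsup>(p-1)/2\<^esup>\<close>.

  If \<open>s\<^sup>2 = -2\<close>, then \<open>Q(y + s) = Q(y)\<close>, and conjugation by \<open>(x - s) / (x + s)\<close> is the shift
  \<open>y \<mapsto> y + s\<close>; hence \<open>x\<close>, and then every \<open>g\<^sub>a\<close>, commutes with \<open>Q\<close>, and \<open>Q k[y]\<close> is a submodule. It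
  is maximal because \<open>x\<close> lowers degrees strictly between \<open>0\<close> and \<open>p\<close> by exactly one, so that every
  nonzero polynomial of degree less than \<open>p\<close> generates \<open>k[y]\<close>.

  If \<open>M\<close> is simple and \<open>x\<^sup>p\<close> acts by zero, then \<open>x\<close> and all \<open>g\<^sub>a - 1\<close> are commuting nilpotent
  operators, so they kill a common vector \<open>v \<noteq> 0\<close> and \<open>M = k[y] v\<close>. The annihilator of \<open>v\<close> in \<open>k[y]\<close>
  lies in some \<open>(y - y\<^sub>0)\<close>. For the \<open>\<beta>\<close> with \<open>Q(y\<^sub>0) = 0\<close> the submodule \<open>Q k[y] v\<close> is proper, hence
  zero, and \<open>M \<cong> k[y] / (Q)\<close>.
\<close>

section \<open>Differential operators on polynomials\<close>

abbreviation scale :: "'k::field \<Rightarrow> 'k poly \<Rightarrow> 'k poly" where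
  "scale \<equiv> Polynomial.smult"

text \<open>\<open>act a f \<phi>\<close> is the image of \<open>f\<close> under \<open>\<phi>(x) g\<^sub>a\<close>, and \<open>der a \<phi>\<close> is
  \<open>[\<phi> g\<^sub>a, y] g\<^sub>a\<^sup>-\<^sup>1\<close>. Here \<open>[x, y] = g\<^sub>1\<close> has been replaced by \<open>1 + x\<^sup>2 / 2\<close>: the element
  \<open>x\<^sup>2 - 2 g\<^sub>1\<close> commutes with \<open>x\<close>, \<open>y\<close> and \<open>g\<^sub>1\<close> and maps the generator \<open>1\<close> to \<open>-2\<close>.\<close>

definition der :: "'k::field \<Rightarrow> 'k poly \<Rightarrow> 'k poly" where
  "der a \<phi> = [:1, 0, 1 / 2:] * pderiv \<phi> + [:0, a:] * \<phi>"

definition act :: "'k::field \<Rightarrow> 'k poly \<Rightarrow> 'k poly \<Rightarrow> 'k poly" where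
  "act a f = fold_coeffs
     (\<lambda>c t \<phi>. [:c * poly \<phi> 0:] + pCons 0 (t \<phi>) + t (der a \<phi>)) f (\<lambda>\<phi>. 0)"

lemma act_0 [simp]: "act a 0 \<phi> = 0"
  by (simp add: act_def)

text \<open>Moves \<open>\<phi> g_a\<close> past \<open>c + y f\<close>: on the constant only
  \<open>\<phi>(0)\<close> survives because \<open>x 1 = 0\<close> and \<open>g_a 1 = 1\<close>, and
  exchanging with \<open>y\<close> leaves the commutator \<open>der a \<phi>\<close>.\<close>

lemma act_pCons:
  "act a (pCons c f) \<phi> = [:c * poly \<phi> 0:] + pCons 0 (act a f \<phi>) + act a f (der a \<phi>)"
  by (cases "f = 0"; cases "c = 0") (simp_all add: act_def fold_coeffs_pCons_eq)

lemma der_add: "der a (\<phi> + \<psi>) = der a \<phi> + der a \<psi>"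
  by (simp add: der_def pderiv_add algebra_simps smult_add_right)

lemma der_smult: "der a (scale b \<phi>) = scale b (der a \<phi>)"
  by (simp add: der_def pderiv_smult smult_add_right)

text \<open>The Leibniz rule for the commutator with \<open>y\<close>, applied to
  \<open>(\<phi> g_a) (\<psi> g_b) = \<phi> \<psi> g_(a+b)\<close>; this is why the group parameters
  add.\<close>

lemma der_mult: "der (a + b) (\<phi> * \<psi>) = der a \<phi> * \<psi> + \<phi> * der b \<psi>"
proof -
  have "[:0, a + b:] = [:0, a:] + [:0, b:]" by simp
  then show ?thesis
    unfolding der_def pderiv_mult by (simp only: algebra_simps)
qed

lemma act_add_left: "act a (f + g) \<phi> = act a f \<phi> + act a g \<phi>"
proof (induction f g arbitrary: \<phi> rule: poly_induct2)
  case (pCons c f d g)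
  then show ?case by (simp add: act_pCons algebra_simps)
qed simp

lemma act_smult_left: "act a (scale b f) \<phi> = scale b (act a f \<phi>)"
  by (induction f arbitrary: \<phi>) (simp_all add: act_pCons algebra_simps smult_add_right)

lemma act_add_right: "act a f (\<phi> + \<psi>) = act a f \<phi> + act a f \<psi>"
  by (induction f arbitrary: \<phi> \<psi>) (simp_all add: act_pCons der_add algebra_simps)

lemma act_smult_right: "act a f (scale b \<phi>) = scale b (act a f \<phi>)"
  by (induction f arbitrary: \<phi>) (simp_all add: act_pCons der_smult algebra_simps smult_add_right)

text \<open>Induction on \<open>f\<close> from the Leibniz rule. The products
  \<open>\<phi>(x) g_a\<close> thus act as a commutative algebra, and commuting two such operators
  amounts to reordering \<open>\<phi> * \<psi>\<close> and \<open>a + b\<close>.\<close>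

lemma act_act: "act a (act b f \<psi>) \<phi> = act (a + b) f (\<phi> * \<psi>)"
proof (induction f arbitrary: \<phi> \<psi>)
  case (pCons c f)
  show ?case
    by (simp add: act_pCons act_add_left pCons.IH der_mult act_add_right algebra_simps)
qed simp

lemma act_zero_one: "act 0 f 1 = f"
proof (induction f)
  case (pCons c f)
  have "der (0::'a) 1 = 0" by (simp add: der_def)
  moreover have "act 0 f 0 = 0" using act_smult_right[of 0 f 0 0] by simp
  ultimately show ?case by (simp add: act_pCons pCons.IH)
qed simp

text \<open>Identifies \<open>g_1\<close> with \<open>1 + x^2 / 2\<close>: this quadratic has
  derivative \<open>x\<close>, so multiplication by it intertwines \<open>der 1\<close> and
  \<open>der 0\<close>.\<close>

lemma act_one:
  assumes "(2::'k::field) \<noteq> 0"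
  shows "act 1 f \<phi> = act 0 f ([:1, 0, 1 / 2:] * \<phi> :: 'k poly)"
proof (induction f arbitrary: \<phi>)
  case (pCons c f)
  have "pderiv [:1, 0, 1 / 2 :: 'k:] = [:0, 1:]"
    using assms by (simp add: pderiv_pCons)
  then have "der 0 ([:1, 0, 1 / 2 :: 'k:] * \<phi>) = [:1, 0, 1 / 2:] * der 1 \<phi>"
    by (simp only: der_def pderiv_mult) (simp add: algebra_simps)
  then show ?case by (simp only: act_pCons pCons.IH) simp
qed simp

section \<open>The operators of \<open>x\<close> and \<open>g_a\<close> on k[y] and their
  relations\<close>

definition X_op :: "'k::field poly \<Rightarrow> 'k poly" where
  "X_op f = act 0 f [:0, 1:]"

definition G_op :: "'k::field \<Rightarrow> 'k poly \<Rightarrow> 'k poly" where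
  "G_op a f = act a f 1"

lemma X_op_0 [simp]: "X_op 0 = 0" and G_op_0 [simp]: "G_op a 0 = 0"
  by (simp_all add: X_op_def G_op_def)

lemma X_op_add: "X_op (f + g) = X_op f + X_op g"
  by (simp add: X_op_def act_add_left)

lemma G_op_add: "G_op a (f + g) = G_op a f + G_op a g"
  by (simp add: G_op_def act_add_left)

lemma X_op_smult: "X_op (scale b f) = scale b (X_op f)"
  by (simp add: X_op_def act_smult_left)

lemma G_op_smult: "G_op a (scale b f) = scale b (G_op a f)"
  by (simp add: G_op_def act_smult_left)

lemma X_op_minus: "X_op (f - g) = X_op f - X_op g"
  using X_op_add[of f "scale (-1) g"] X_op_smult[of "-1" g] by simp

lemma G_op_minus: "G_op a (f - g) = G_op a f - G_op a g"
  using G_op_add[of a f "scale (-1) g"] G_op_smult[of a "-1" g] by simp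

lemma G_op_zero: "G_op 0 f = f"
  by (simp add: G_op_def act_zero_one)

lemma G_op_G_op: "G_op a (G_op b f) = G_op (a + b) f"
  by (simp add: G_op_def act_act)

lemma G_op_X_op: "G_op a (X_op f) = X_op (G_op a f)"
  by (simp add: G_op_def X_op_def act_act)

text \<open>The relation \<open>g_a y = (y + a x) g_a\<close>; the correction term is
  \<open>der a 1 = a x\<close>.\<close>

lemma G_op_pCons: "G_op a (pCons c f) = pCons c (G_op a f) + scale a (X_op (G_op a f))"
proof -
  have "der a 1 = scale a [:0, 1:]" by (simp add: der_def)
  then show ?thesis
    by (simp add: G_op_def X_op_def act_pCons act_act act_smult_right flip: act_smult_right del: smult_pCons)
qed

text \<open>The relation \<open>x y = y x + g_1\<close>: the commutator \<open>der 0 x\<close> is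
  \<open>1 + x^2 / 2\<close>, which acts as \<open>g_1\<close>.\<close>

lemma X_op_pCons:
  assumes "(2::'k::field) \<noteq> 0"
  shows "X_op (pCons c f) = pCons 0 (X_op f) + G_op 1 (f :: 'k poly)"
proof -
  have "der 0 [:0, 1:] = [:1, 0, 1 / 2 :: 'k:]" by (simp add: der_def pderiv_pCons)
  then show ?thesis using assms by (simp add: X_op_def G_op_def act_pCons act_one)
qed

text \<open>Since \<open>g_1\<close> acts as \<open>1 + x^2 / 2\<close>, the element
  \<open>x^2 - 2 g_1\<close> is the scalar -2 on all of k[y], not only on the generator.\<close>

lemma X_op_X_op:
  assumes "(2::'k::field) \<noteq> 0"
  shows "X_op (X_op f) = scale 2 (G_op 1 f) - scale 2 (f :: 'k poly)"
proof -
  have e: "[:1, 0, 1 / 2 :: 'k:] * 1 = 1 + scale (1/2) ([:0, 1:] * [:0, 1:])"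
    by (simp add: one_pCons)
  have "G_op 1 f = f + scale (1/2) (X_op (X_op f))"
    unfolding G_op_def X_op_def act_one[OF assms] e act_act act_add_right act_smult_right
      act_zero_one add_0_left ..
  then show ?thesis using assms by (simp add: smult_add_right)
qed

lemma X_op_const: "X_op [:c:] = 0"
  by (simp add: X_op_def act_pCons)

lemma G_op_const: "G_op a [:c:] = [:c:]"
  by (simp add: G_op_def act_pCons)

text \<open>\<open>X\<close> behaves like differentiation on leading terms and \<open>G_a\<close> is
  unipotent. The claims are proved together because each recursion uses the other operator. At
  \<open>n = 0\<close>, where \<open>n - 1 = 0\<close>, they say that \<open>X\<close> kills
  constants.\<close>

lemma degree_ops:
  assumes "(2::'k::field) \<noteq> 0" and "degree f \<le> n"
  shows "degree (X_op f) \<le> n - 1 \<and> coeff (X_op f) (n - 1) = of_nat n * coeff f n \<and>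
    degree (G_op a f) \<le> n \<and> coeff (G_op a f) n = coeff (f :: 'k poly) n"
  using assms(2)
proof (induction n arbitrary: f a)
  case 0
  then obtain c where "f = [:c:]" by (metis degree_eq_zeroE le_zero_eq)
  then show ?case by (simp add: X_op_const G_op_const)
next
  case (Suc n)
  obtain c g where f: "f = pCons c g" by (cases f) auto
  with Suc.prems have g: "degree g \<le> n" by (cases "g = 0") auto
  have IH: "degree (X_op g) \<le> n - 1" "coeff (X_op g) (n - 1) = of_nat n * coeff g n"
    "degree (G_op b g) \<le> n" "coeff (G_op b g) n = coeff g n" for b
    using Suc.IH[OF g] by auto
  \<comment> \<open>The induction runs over the degree bound, so the hypothesis also applies to
    \<open>G_op a g\<close>, which is not a part of \<open>f\<close>.\<close>
  have XG: "degree (X_op (G_op a g)) \<le> n - 1" using Suc.IH[OF IH(3)] by auto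
  have X: "X_op f = pCons 0 (X_op g) + G_op 1 g" using X_op_pCons[OF assms(1)] f by simp
  have G: "G_op a f = pCons c (G_op a g) + scale a (X_op (G_op a g))"
    using G_op_pCons f by simp
  \<comment> \<open>For \<open>n = 0\<close> the truncated bound \<open>n - 1\<close> would only
    give degree at most 1 here; instead \<open>X\<close> kills the constant
    \<open>g\<close>.\<close>
  have "degree (pCons 0 (X_op g)) \<le> n"
  proof (cases "n = 0")
    case True
    then have "g = [:coeff g 0:]" using g by (metis degree_0_id le_zero_eq)
    then show ?thesis by (metis X_op_const degree_0 le0 pCons_0_0)
  next
    case False
    then show ?thesis using IH(1) degree_pCons_le[of 0 "X_op g"] by linarith
  qed
  then have 1: "degree (X_op f) \<le> Suc n - 1" using X IH(3) by (simp add: degree_add_le)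
  have 2: "coeff (X_op f) (Suc n - 1) = of_nat (Suc n) * coeff f (Suc n)"
  proof (cases n)
    case 0
    then show ?thesis using X IH f by simp
  next
    case (Suc m)
    then show ?thesis using X IH f by (simp add: algebra_simps)
  qed
  have "degree (pCons c (G_op a g)) \<le> Suc n"
    using IH(3)[of a] degree_pCons_le[of c "G_op a g"] by linarith
  moreover have "degree (scale a (X_op (G_op a g))) \<le> n"
    using XG degree_smult_le[of a "X_op (G_op a g)"] by linarith
  ultimately have 3: "degree (G_op a f) \<le> Suc n" using G by (simp add: degree_add_le)
  have "coeff (X_op (G_op a g)) (Suc n) = 0"
    using XG by (intro coeff_eq_0) simp
  then have 4: "coeff (G_op a f) (Suc n) = coeff f (Suc n)" using G IH f by simp
  show ?case using 1 2 3 4 by blast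
qed

lemmas degree_X_op = degree_ops[THEN conjunct1]
  and coeff_X_op = degree_ops[THEN conjunct2, THEN conjunct1]
  and degree_G_op = degree_ops[THEN conjunct2, THEN conjunct2, THEN conjunct1]
  and coeff_G_op = degree_ops[THEN conjunct2, THEN conjunct2, THEN conjunct2]

text \<open>As \<open>X\<close> and \<open>y\<close> are odd and \<open>G\<close> is even, substituting \<open>-y\<close> for \<open>y\<close> commutes with \<open>G\<close>.\<close>

abbreviation neg :: "'k::field poly \<Rightarrow> 'k poly" where
  "neg f \<equiv> f \<circ>\<^sub>p [:0, - 1:]"

lemma der_neg: "der a (neg \<phi>) = - neg (der a \<phi>)"
  by (simp add: der_def pderiv_pcompose pcompose_add pcompose_mult pcompose_pCons
      pcompose_smult pderiv_pCons)

text \<open>The relations survive \<open>x \<mapsto> -x\<close>, \<open>y \<mapsto> -y\<close>,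
  \<open>g_a \<mapsto> g_a\<close>; the sign from the commutator with \<open>y\<close> is supplied
  by \<open>der_neg\<close>.\<close>

lemma act_neg: "act a (neg f) (neg \<phi>) = neg (act a f \<phi>)"
proof (induction f arbitrary: \<phi>)
  case (pCons c f)
  have m: "[:0, - 1:] * h = - pCons 0 h" for h :: "'a poly" by simp
  have u1: "act a (- h) \<psi> = - act a h \<psi>" for h \<psi>
    using act_smult_left[of a "-1" h \<psi>] by simp
  have u2: "act a h (- \<psi>) = - act a h \<psi>" for h \<psi>
    using act_smult_right[of a h "-1" \<psi>] by simp
  have "act a (neg (pCons c f)) (neg \<phi>) = act a ([:c:] - pCons 0 (neg f)) (neg \<phi>)"
    by (simp add: pcompose_pCons m)
  also have "\<dots> = act a [:c:] (neg \<phi>) - act a (pCons 0 (neg f)) (neg \<phi>)"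
    using act_add_left[of a "[:c:]" "- pCons 0 (neg f)" "neg \<phi>"] u1[of "pCons 0 (neg f)" "neg \<phi>"] by simp
  also have "\<dots> = neg (act a (pCons c f) \<phi>)"
    by (simp add: act_pCons der_neg u2 pCons.IH pcompose_add pcompose_pCons m poly_pcompose)
  finally show ?case .
qed simp

lemma G_op_neg: "G_op a (neg f) = neg (G_op a f)"
  using act_neg[of a f 1] by (simp add: G_op_def pcompose_1)

text \<open>The operator identity \<open>(X - s) f(y) (X + s) = (X + s) f(y + s) (X - s)\<close>: conjugation by
  \<open>(X - s) / (X + s)\<close> shifts \<open>y\<close> by \<open>s\<close>, since \<open>[X, y] = 1 + X\<^sup>2 / 2 = (X - s) (X + s) / 2\<close>.\<close>

lemma X_op_shift:
  fixes s :: "'k::field"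
  assumes two: "(2::'k) \<noteq> 0" and s: "s * s = - 2"
  defines "A \<equiv> \<lambda>h. X_op h - scale s h" and "B \<equiv> \<lambda>h. X_op h + scale s h"
  shows "A (f * B h) = B (f \<circ>\<^sub>p [:s, 1:] * A h)"
proof (induction f)
  case (pCons c f)
  \<comment> \<open>\<open>(X - s) (X + s) = X^2 - s^2 = X^2 + 2\<close>, and
    \<open>X^2 = 2 G_1 - 2\<close>.\<close>
  have AB: "A (B h) = scale 2 (G_op 1 h)" "B (A h) = scale 2 (G_op 1 h)" for h
    using s by (simp_all add: A_def B_def X_op_add X_op_minus X_op_smult X_op_X_op[OF two] smult_diff_right
        smult_add_right)
  have lin: "A (h + h') = A h + A h'" "B (h + h') = B h + B h'"
    "A (scale b h) = scale b (A h)" "B (scale b h) = scale b (B h)" for b h h'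
    by (simp_all add: A_def B_def X_op_add X_op_smult algebra_simps smult_add_right mult.commute
        smult_diff_right)
  have BA: "B h = A h + scale (2 * s) h" for h
  proof -
    have "scale (2 * s) h = scale s h + scale s h" by (simp flip: smult_add_left)
    then show ?thesis by (simp add: A_def B_def)
  qed
  have y: "A (pCons 0 h) = pCons 0 (A h) + G_op 1 h" "B (pCons 0 h) = pCons 0 (B h) + G_op 1 h" for h
    by (simp_all add: A_def B_def X_op_pCons[OF two])
  have G: "G_op 1 h = scale (1 / 2) (A (B h))" "G_op 1 h = scale (1/2) (B (A h))" for h
    using AB two by simp_all
  let ?u = "f * B h" and ?w = "f \<circ>\<^sub>p [:s, 1:] * A h"
  have "A (pCons c f * B h) = scale c (A (B h)) + (pCons 0 (A ?u) + scale (1 / 2) (B (A ?u)))"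
    by (simp add: lin y flip: G(2))
  also have "\<dots> = scale c (B (A h)) + (pCons 0 (B ?w) + scale (1 / 2) (B (B ?w)))"
    using AB pCons.IH by simp
  \<comment> \<open>Replacing one \<open>B\<close> by \<open>A + 2 s\<close> turns the second-order
    term into \<open>G_1 ?w + s B ?w\<close>: the first summand lets \<open>y\<close> pass through
    \<open>B\<close>, the second shifts \<open>y\<close> to \<open>y + s\<close>.\<close>
  also have "scale (1 / 2) (B (B ?w)) = scale (1 / 2) (A (B ?w)) + scale s (B ?w)"
    using two by (subst BA[of "B ?w"]) (simp add: smult_add_right)
  also have "scale c (B (A h)) + (pCons 0 (B ?w) + (scale (1 / 2) (A (B ?w)) + scale s (B ?w)))
     = B (scale c (A h) + (pCons 0 ?w + scale s ?w))"
    using G(1)[of ?w] by (simp add: lin y)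
  also have "\<dots> = B (pCons c f \<circ>\<^sub>p [:s, 1:] * A h)"
    by (simp add: pcompose_pCons algebra_simps)
  finally show ?case .
qed (simp add: A_def B_def)

text \<open>For shift-invariant \<open>q\<close> the operator identity reads
  \<open>(X - s) q (X + s) = (X + s) q (X - s)\<close>. Expanding leaves
  \<open>2 s (X q - q X) = 0\<close>, and \<open>2 s\<close> is invertible since
  \<open>s^2 = -2\<close> is nonzero.\<close>

lemma X_op_mult_periodic:
  fixes s :: "'k::field"
  assumes two: "(2::'k) \<noteq> 0" and s: "s * s = - 2" and q: "q \<circ>\<^sub>p [:s, 1:] = q"
  shows "X_op (q * h) = q * X_op h"
proof -
  have "X_op (q * X_op h + scale s (q * h)) - scale s (q * X_op h + scale s (q * h))
      = X_op (q * X_op h - scale s (q * h)) + scale s (q * X_op h - scale s (q * h))"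
    using X_op_shift[OF two s, of q h] q by (simp add: algebra_simps)
  then have "scale s (X_op (q * h) - q * X_op h) = - scale s (X_op (q * h) - q * X_op h)"
    by (simp add: X_op_add X_op_minus X_op_smult smult_add_right smult_diff_right algebra_simps)
  then have "scale s (X_op (q * h) - q * X_op h) + scale s (X_op (q * h) - q * X_op h) = 0"
    by (metis add.right_inverse)
  then have "scale (2 * s) (X_op (q * h) - q * X_op h) = 0"
    by (simp only: mult_2 smult_add_left)
  moreover have "2 * s \<noteq> 0" using s two by auto
  ultimately show ?thesis by simp
qed

lemma pcompose_pow: "(f ^ n) \<circ>\<^sub>p g = (f \<circ>\<^sub>p g) ^ n" for f g :: "'k::field poly"
  by (induction n) (simp_all add: pcompose_mult pcompose_1)

section \<open>The polynomial \<open>Q\<close> in odd characteristic p\<close>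

locale odd_char =
  fixes p :: nat and K :: "'k::alg_closed_field itself"
  assumes prime_p: "prime p" and odd_p: "odd p" and of_nat_p: "of_nat p = (0::'k)"
begin

lemma CHAR_eq: "CHAR('k) = p"
  using prime_p of_nat_p by (metis CHAR_not_1' One_nat_def of_nat_eq_0_iff_char_dvd prime_nat_iff)

lemma of_nat_nonzero: "of_nat n \<noteq> (0::'k)" if "0 < n" "n < p"
  using that by (metis CHAR_eq nat_dvd_not_less of_nat_eq_0_iff_char_dvd)

lemma p_gt_2: "p > 2"
  using prime_p odd_p by (metis prime_ge_2_nat le_neq_implies_less even_numeral)

lemma two_nonzero: "(2::'k) \<noteq> 0"
  using of_nat_nonzero[of 2] p_gt_2 by simp

text \<open>By Euler's criterion this is the Legendre symbol of -2 modulo p, read in k; it is the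
  scalar by which \<open>(x^2 - 2 g_1)^((p - 1) / 2)\<close> acts.\<close>

definition eps :: 'k where "eps = (- 2) ^ ((p - 1) div 2)"

text \<open>The image of \<open>Y - \<beta>\<close> in \<open>\<Delta>\<^sub>0 = k[y]\<close>.\<close>

definition Q :: "'k \<Rightarrow> 'k poly" where
  "Q \<beta> = Polynomial.monom 1 p - scale eps [:0, 1:] - [:\<beta>:]"

lemma Q_0: "Q \<beta> = Q 0 - [:\<beta>:]"
  by (simp add: Q_def)

lemma degree_Q: "degree (Q \<beta>) = p"
proof -
  have "degree (- scale eps [:0, 1:] - [:\<beta>:]) < p"
    using p_gt_2 by (intro degree_lessI) (auto simp: coeff_pCons split: nat.splits)
  moreover have "Q \<beta> = Polynomial.monom 1 p + (- scale eps [:0, 1:] - [:\<beta>:])"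
    unfolding Q_def by (simp only: diff_conv_add_uminus add.assoc)
  ultimately show ?thesis
    by (metis degree_add_eq_left degree_monom_eq one_neq_zero)
qed

lemma Q_nonzero: "Q \<beta> \<noteq> 0"
  using degree_Q p_gt_2 by (metis degree_0 not_less_zero)

text \<open>Frobenius is additive, so the shift changes \<open>y^p - eps y\<close> by
  \<open>s^p - eps s\<close>; this vanishes since
  \<open>s^p = s (s^2)^((p - 1) / 2)\<close>.\<close>

lemma Q_pcompose:
  assumes s: "s * s = (- 2 :: 'k)"
  shows "Q \<beta> \<circ>\<^sub>p [:s, 1:] = Q \<beta>"
proof -
  have CH: "CHAR('k poly) = p" using CHAR_eq by simp
  have c: "[:s:] ^ n = [:s ^ n:]" for n by (induction n) (simp_all add: one_pCons)
  have "[:s, 1:] ^ p = ([:s:] + [:0, 1:]) ^ p" by simp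
  also have "\<dots> = [:s:] ^ p + [:0, 1:] ^ p"
    using freshmans_dream[where x = "[:s:]" and y = "[:0, 1:]"] CH prime_p by simp
  also have "[:s:] ^ p = [:s ^ p:]" by (rule c)
  finally have 1: "[:s, 1:] ^ p = [:s ^ p:] + [:0, 1:] ^ p" .
  have "s ^ p = s ^ (2 * ((p - 1) div 2) + 1)"
    using odd_p by (intro arg_cong[where f = "(^) s"]) (auto elim!: oddE)
  also have "\<dots> = eps * s" by (simp add: power_mult power2_eq_square s eps_def)
  finally have 2: "s ^ p = eps * s" .
  have "Q \<beta> \<circ>\<^sub>p [:s, 1:] = [:s, 1:] ^ p - scale eps [:s, 1:] - [:\<beta>:]"
    by (simp add: Q_def monom_altdef pcompose_diff pcompose_smult pcompose_pow pcompose_pCons)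
  also have "\<dots> = Q \<beta>" unfolding 1 Q_def by (simp add: 2 monom_altdef)
  finally show ?thesis .
qed

text \<open>As k is algebraically closed, -2 has a square root \<open>s\<close>, and
  \<open>Q\<close> is periodic with period \<open>s\<close>.\<close>

lemma X_op_Q: "X_op (Q \<beta> * h) = Q \<beta> * X_op h"
proof -
  obtain s :: 'k where "s ^ 2 = - 2"
    using nth_root_exists[of 2 "- 2 :: 'k"] by auto
  then have "s * s = - 2" by (simp add: power2_eq_square)
  then show ?thesis using X_op_mult_periodic[OF two_nonzero] Q_pcompose by blast
qed

text \<open>If \<open>n = degree f\<close> were positive, the coefficient of \<open>X f\<close> at
  \<open>n - 1\<close> would be \<open>n\<close> times the leading one, and \<open>n < p\<close> is
  invertible in k.\<close>

lemma X_op_eq_0_imp_const: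
  assumes "X_op f = 0" and "degree f < p"
  shows "degree (f :: 'k poly) = 0"
proof (rule ccontr)
  assume n: "degree f \<noteq> 0"
  have "of_nat (degree f) * coeff f (degree f) = 0"
    using coeff_X_op[OF two_nonzero, of f "degree f"] assms by simp
  then show False using n assms(2) of_nat_nonzero[of "degree f"] by auto
qed

text \<open>The difference \<open>G Q - Q\<close> has degree below \<open>p\<close> and is killed by \<open>X\<close>, hence constant; it is
  also odd, hence zero.\<close>

lemma G_op_Q_1: "G_op a (Q \<beta>) = Q \<beta>"
proof -
  let ?m = "Polynomial.monom (1::'k) p"
  \<comment> \<open>\<open>G_a\<close> fixes \<open>y\<close> and the constants, so only
    \<open>y^p\<close> contributes to \<open>G_a Q - Q\<close>. Working with this monomial alone
    exhibits the difference as odd.\<close>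
  define k where "k = G_op a ?m - ?m"
  have "G_op a [:0, 1:] = [:0, 1:]" by (simp add: G_op_pCons G_op_const X_op_const)
  then have k: "G_op a (Q \<beta>) - Q \<beta> = k"
    by (simp add: Q_def k_def G_op_minus G_op_smult G_op_const del: smult_pCons)
  have dm: "degree ?m \<le> p" by (simp add: degree_monom_eq)
  have "coeff k i = 0" if "p \<le> i" for i
  proof (cases "i = p")
    case False
    then have "degree (G_op a ?m) < i" "degree ?m < i"
      using that degree_G_op[OF two_nonzero dm, of a] dm by linarith+
    then show ?thesis unfolding k_def by (simp only: coeff_diff coeff_eq_0 diff_self)
  qed (use coeff_G_op[OF two_nonzero dm] in \<open>simp add: k_def\<close>)
  then have "degree k < p"
    using p_gt_2 by (intro degree_lessI) auto
  \<comment> \<open>\<open>X\<close> commutes with \<open>Q\<close> and kills 1, hence kills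
    \<open>Q\<close>; as it commutes with \<open>G_a\<close>, it kills \<open>k\<close> too.\<close>
  moreover have "X_op (Q \<beta> * 1) = 0"
    by (simp only: X_op_Q one_pCons X_op_const mult_zero_right)
  then have "X_op (Q \<beta>) = 0" by simp
  then have "X_op k = 0"
    by (simp flip: k G_op_X_op add: X_op_minus)
  ultimately have "degree k = 0" by (intro X_op_eq_0_imp_const)
  then obtain c where c: "k = [:c:]" by (rule degree_eq_zeroE)
  have u: "G_op a (- h) = - G_op a h" for h using G_op_minus[of a 0 h] by simp
  have "neg ?m = - ?m"
  proof -
    have "[:0, - 1:] = - [:0, 1 :: 'k:]" by simp
    then have "[:0, - 1:] ^ p = - ([:0, 1 :: 'k:] ^ p)" by (metis odd_p power_minus_odd)
    then show ?thesis by (simp add: monom_altdef pcompose_pow pcompose_pCons)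
  qed
  then have "neg k = - k"
    unfolding k_def by (simp add: pcompose_diff u flip: G_op_neg)
  then have "2 * c = 0" using c by (simp add: eq_neg_iff_add_eq_0)
  then have "k = 0" using two_nonzero c by simp
  then show ?thesis using k by simp
qed

text \<open>Induction on \<open>h\<close>: the recursion of \<open>G_a\<close> on
  \<open>pCons\<close> involves only multiplication by \<open>y\<close> and \<open>X\<close>, both
  of which commute with \<open>Q\<close>; constant terms are covered by
  \<open>G_op_Q_1\<close>.\<close>

lemma G_op_Q: "G_op a (Q \<beta> * h) = Q \<beta> * G_op a h"
proof (induction h)
  case (pCons c h)
  have "G_op a (Q \<beta> * pCons c h) = G_op a (scale c (Q \<beta>) + pCons 0 (Q \<beta> * h))"
    by simp
  also have "\<dots> = scale c (Q \<beta>) + (pCons 0 (Q \<beta> * G_op a h) + scale a (Q \<beta> * X_op (G_op a h)))"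
    by (simp only: G_op_add G_op_smult G_op_pCons G_op_Q_1 pCons.IH X_op_Q)
  also have "\<dots> = Q \<beta> * G_op a (pCons c h)"
    by (simp add: G_op_pCons algebra_simps)
  finally show ?case .
qed simp

text \<open>Below degree p the operator \<open>X\<close> lowers the degree of nonconstant
  polynomials and kills only constants, so iterating it on \<open>f\<close> reaches a nonzero
  constant.\<close>

lemma one_mem_if_low_degree:
  assumes scale: "\<And>c f. f \<in> I \<Longrightarrow> scale c f \<in> I" and X: "\<And>f. f \<in> I \<Longrightarrow> X_op f \<in> I"
    and "f \<in> I" "f \<noteq> 0" "degree (f :: 'k poly) < p"
  shows "1 \<in> I"
  using assms(3-5)
proof (induction "degree f" arbitrary: f rule: less_induct)
  case less
  show ?case
  proof (cases "degree f = 0")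
    case True
    then obtain c where c: "f = [:c:]" by (rule degree_eq_zeroE)
    with less.prems have "scale (1 / c) f = 1" by (simp add: one_pCons)
    then show ?thesis using scale[OF less.prems(1), of "1 / c"] by simp
  next
    case False
    then have "X_op f \<noteq> 0" using X_op_eq_0_imp_const[of f] less.prems by auto
    moreover have "degree (X_op f) < degree f"
      using degree_X_op[OF two_nonzero, of f "degree f"] False by linarith
    ultimately show ?thesis using less X by (meson order.strict_trans)
  qed
qed

end

section \<open>Modules over noncommutative rings\<close>

context left_module
begin

declare smult_closed [simp, intro] smult_one [simp]

lemma smult_l_null [simp]: "x \<in> carrier M \<Longrightarrow> \<zero> \<odot>\<^bsub>M\<^esub> x = \<zero>\<^bsub>M\<^esub>"
  using smult_l_distr[of \<zero> \<zero> x] by (metis M.add.r_cancel_one' R.l_zero R.zero_closed smult_closed)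

lemma smult_r_null [simp]: "a \<in> carrier R \<Longrightarrow> a \<odot>\<^bsub>M\<^esub> \<zero>\<^bsub>M\<^esub> = \<zero>\<^bsub>M\<^esub>"
  using smult_r_distr[of a "\<zero>\<^bsub>M\<^esub>" "\<zero>\<^bsub>M\<^esub>"]
  by (metis M.add.r_cancel_one' M.l_zero M.zero_closed smult_closed)

lemma smult_l_minus: "a \<in> carrier R \<Longrightarrow> x \<in> carrier M \<Longrightarrow> (\<ominus> a) \<odot>\<^bsub>M\<^esub> x = \<ominus>\<^bsub>M\<^esub> (a \<odot>\<^bsub>M\<^esub> x)"
  using smult_l_distr[of "\<ominus> a" a x] by (metis M.minus_equality R.a_inv_closed R.l_neg smult_closed smult_l_null)

lemma smult_l_diff:
  "a \<in> carrier R \<Longrightarrow> b \<in> carrier R \<Longrightarrow> x \<in> carrier M \<Longrightarrow>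
    (a \<ominus> b) \<odot>\<^bsub>M\<^esub> x = a \<odot>\<^bsub>M\<^esub> x \<ominus>\<^bsub>M\<^esub> b \<odot>\<^bsub>M\<^esub> x"
  by (simp add: R.minus_eq M.minus_eq smult_l_distr smult_l_minus)

lemma submoduleI:
  assumes "N \<subseteq> carrier M" "N \<noteq> {}"
    and "\<And>x y. x \<in> N \<Longrightarrow> y \<in> N \<Longrightarrow> x \<oplus>\<^bsub>M\<^esub> y \<in> N"
    and "\<And>a x. a \<in> carrier R \<Longrightarrow> x \<in> N \<Longrightarrow> a \<odot>\<^bsub>M\<^esub> x \<in> N"
  shows "submodule N R M"
proof -
  have minus: "\<ominus>\<^bsub>M\<^esub> x \<in> N" if "x \<in> N" for x
    using that assms(1) assms(4)[of "\<ominus> \<one>" x] smult_l_minus[of \<one> x] by auto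
  have "\<zero>\<^bsub>M\<^esub> \<in> N"
  proof -
    obtain x where "x \<in> N" using assms(2) by auto
    then show ?thesis using assms(1) assms(4)[of \<zero> x] by auto
  qed
  then show ?thesis
    using assms minus
    by (intro submodule.intro subgroup.intro submodule_axioms.intro) (auto simp: a_inv_def)
qed

lemma submoduleD:
  assumes "submodule N R M"
  shows "N \<subseteq> carrier M" "\<zero>\<^bsub>M\<^esub> \<in> N" "\<And>x y. x \<in> N \<Longrightarrow> y \<in> N \<Longrightarrow> x \<oplus>\<^bsub>M\<^esub> y \<in> N"
    "\<And>a x. a \<in> carrier R \<Longrightarrow> x \<in> N \<Longrightarrow> a \<odot>\<^bsub>M\<^esub> x \<in> N"
    "\<And>x. x \<in> N \<Longrightarrow> \<ominus>\<^bsub>M\<^esub> x \<in> N" "subgroup N (add_monoid M)"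
  using submodule.axioms(1)[OF assms] submodule.smult_closed[OF assms]
    subgroup.subset[of N "add_monoid M"] subgroup.one_closed[of N "add_monoid M"]
    subgroup.m_closed[of N "add_monoid M"] subgroup.m_inv_closed[of N "add_monoid M"]
  by (auto simp: a_inv_def)

lemma carrier_submodule: "submodule (carrier M) R M"
  by (intro submoduleI) auto

lemma submodule_generated_submodule:
  assumes "S \<subseteq> carrier M"
  shows "submodule (submodule_generated R M S) R M"
proof -
  have "submodule_generated R M S \<subseteq> carrier M"
    using assms carrier_submodule unfolding submodule_generated_def by blast
  moreover have "\<zero>\<^bsub>M\<^esub> \<in> submodule_generated R M S"
    unfolding submodule_generated_def using submoduleD(2) by blast
  ultimately show ?thesis
    by (intro submoduleI) (auto simp: submodule_generated_def intro: submoduleD)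
qed

lemma submodule_generated_minimal:
  "submodule N R M \<Longrightarrow> S \<subseteq> N \<Longrightarrow> submodule_generated R M S \<subseteq> N"
  unfolding submodule_generated_def by blast

lemma submodule_generated_incl: "S \<subseteq> submodule_generated R M S"
  unfolding submodule_generated_def by blast

end

lemma (in ring) regular_module_left_module: "left_module R (regular_module R)"
proof (intro left_module.intro left_module_axioms.intro)
  show "abelian_group (regular_module R)"
    by (rule abelian_groupI)
      (auto simp: regular_module_def a_assoc l_neg intro: add.m_comm
        intro!: bexI[of _ "\<ominus> x" for x])
qed (auto simp: regular_module_def l_distr r_distr m_assoc ring_axioms)

section \<open>Quotients of left modules\<close>

context left_module
begin

context
  fixes N assumes N: "submodule N R M"
begin

interpretation abelian_subgroup N M
proof (rule abelian_subgroupI3)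
  show "additive_subgroup N M" using submoduleD(6)[OF N] by (rule additive_subgroup.intro)
qed (rule M.abelian_group_axioms)

lemma quotient_carrier: "carrier (quotient_module M N) = {N +>\<^bsub>M\<^esub> m | m. m \<in> carrier M}"
  by (auto simp: quotient_module_def A_RCOSETS_def')

lemma quotient_add:
  "m \<in> carrier M \<Longrightarrow> m' \<in> carrier M \<Longrightarrow>
    (N +>\<^bsub>M\<^esub> m) \<oplus>\<^bsub>quotient_module M N\<^esub> (N +>\<^bsub>M\<^esub> m') = N +>\<^bsub>M\<^esub> (m \<oplus>\<^bsub>M\<^esub> m')"
  by (simp add: quotient_module_def a_rcos_sum)

lemma quotient_eq:
  assumes "m \<in> carrier M" "m' \<in> carrier M"
  shows "N +>\<^bsub>M\<^esub> m = N +>\<^bsub>M\<^esub> m' \<longleftrightarrow> m \<ominus>\<^bsub>M\<^esub> m' \<in> N"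
  using a_rcos_module[OF assms(2,1)] a_rcos_self[OF assms(1)]
    M.a_repr_independence[OF _ assms(2) submoduleD(6)[OF N]]
  by (auto simp: M.minus_eq)

text \<open>The product is encoded as a union over all representatives; they all yield one coset
  because \<open>N\<close> contains \<open>a n\<close> for each \<open>n\<close> in
  \<open>N\<close>.\<close>

lemma quotient_smult:
  assumes a: "a \<in> carrier R" and m: "m \<in> carrier M"
  shows "a \<odot>\<^bsub>quotient_module M N\<^esub> (N +>\<^bsub>M\<^esub> m) = N +>\<^bsub>M\<^esub> (a \<odot>\<^bsub>M\<^esub> m)"
proof -
  have "N +>\<^bsub>M\<^esub> (a \<odot>\<^bsub>M\<^esub> m') = N +>\<^bsub>M\<^esub> (a \<odot>\<^bsub>M\<^esub> m)" if m': "m' \<in> N +>\<^bsub>M\<^esub> m" for m'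
  proof -
    obtain n where n: "n \<in> N" "m' = n \<oplus>\<^bsub>M\<^esub> m" using m' by (auto simp: a_r_coset_def r_coset_def)
    then have "n \<in> carrier M" using submoduleD(1)[OF N] by blast
    then have "a \<odot>\<^bsub>M\<^esub> m' = a \<odot>\<^bsub>M\<^esub> n \<oplus>\<^bsub>M\<^esub> a \<odot>\<^bsub>M\<^esub> m" using n a m smult_r_distr by simp
    moreover have "a \<odot>\<^bsub>M\<^esub> n \<in> N" using submoduleD(4)[OF N] a n by blast
    ultimately have "a \<odot>\<^bsub>M\<^esub> m' \<in> N +>\<^bsub>M\<^esub> (a \<odot>\<^bsub>M\<^esub> m)" by (auto simp: a_r_coset_def r_coset_def)
    then show ?thesis using M.a_repr_independence[OF _ _ submoduleD(6)[OF N]] a m by simp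
  qed
  moreover have "m \<in> N +>\<^bsub>M\<^esub> m" using m by (rule a_rcos_self)
  ultimately have "(\<Union>m'\<in>N +>\<^bsub>M\<^esub> m. N +>\<^bsub>M\<^esub> (a \<odot>\<^bsub>M\<^esub> m')) = N +>\<^bsub>M\<^esub> (a \<odot>\<^bsub>M\<^esub> m)" by blast
  then show ?thesis by (simp add: quotient_module_def)
qed

lemma quotient_left_module: "left_module R (quotient_module M N)"
proof (intro left_module.intro left_module_axioms.intro)
  have zero: "\<zero>\<^bsub>quotient_module M N\<^esub> = N +>\<^bsub>M\<^esub> \<zero>\<^bsub>M\<^esub>"
    using submoduleD(1)[OF N] by (simp add: quotient_module_def M.a_coset_add_zero)
  show "abelian_group (quotient_module M N)"
  proof (rule abelian_groupI)
    fix x assume "x \<in> carrier (quotient_module M N)"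
    then obtain m where m: "m \<in> carrier M" "x = N +>\<^bsub>M\<^esub> m" by (auto simp: quotient_carrier)
    then have "(N +>\<^bsub>M\<^esub> \<ominus>\<^bsub>M\<^esub> m) \<oplus>\<^bsub>quotient_module M N\<^esub> x = \<zero>\<^bsub>quotient_module M N\<^esub>"
      by (simp add: quotient_add zero M.l_neg)
    then show "\<exists>y\<in>carrier (quotient_module M N).
        y \<oplus>\<^bsub>quotient_module M N\<^esub> x = \<zero>\<^bsub>quotient_module M N\<^esub>"
      using m(1) by (intro bexI[where x = "N +>\<^bsub>M\<^esub> \<ominus>\<^bsub>M\<^esub> m"]) (auto simp: quotient_carrier)
  qed (auto simp: quotient_carrier quotient_add zero M.a_ac)
qed (auto simp: quotient_carrier quotient_add quotient_smult smult_l_distr smult_r_distr smult_assoc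
    R.ring_axioms)

end

end

section \<open>Algebras over a field and evaluation of polynomials\<close>

locale ring_over_field = ring R for R :: "('a, 'c) ring_scheme" (structure) +
  fixes \<iota> :: "'k::field \<Rightarrow> 'a"
  assumes const_closed [simp, intro]: "\<iota> c \<in> carrier R"
    and const_add: "\<iota> (c + d) = \<iota> c \<oplus> \<iota> d"
    and const_mult: "\<iota> (c * d) = \<iota> c \<otimes> \<iota> d"
    and const_one: "\<iota> 1 = \<one>"
    and const_central: "t \<in> carrier R \<Longrightarrow> \<iota> c \<otimes> t = t \<otimes> \<iota> c"
begin

lemma const_zero: "\<iota> 0 = \<zero>"
  using const_add[of 0 0] by (metis add.r_cancel_one' add_0 const_closed)

text \<open>Horner form of substituting \<open>t\<close>. It is multiplicative in a noncommutative
  ring as well, because the coefficients are central.\<close>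

definition eval :: "'a \<Rightarrow> 'k poly \<Rightarrow> 'a" where
  "eval t f = fold_coeffs (\<lambda>c z. \<iota> c \<oplus> t \<otimes> z) f \<zero>"

context
  fixes t assumes t [simp, intro]: "t \<in> carrier R"
begin

lemma eval_0 [simp]: "eval t 0 = \<zero>"
  by (simp add: eval_def)

lemma eval_pCons: "eval t (pCons c f) = \<iota> c \<oplus> t \<otimes> eval t f"
  by (cases "c = 0"; cases "f = 0") (simp_all add: eval_def const_zero)

lemma eval_closed [simp, intro]: "eval t f \<in> carrier R"
  by (induction f) (simp_all add: eval_pCons)

lemma eval_const: "eval t [:c:] = \<iota> c"
  by (simp add: eval_pCons)

lemma eval_pCons_0: "eval t (pCons 0 f) = t \<otimes> eval t f"
  by (simp add: eval_pCons const_zero)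

lemma eval_add: "eval t (f + g) = eval t f \<oplus> eval t g"
proof (induction f g rule: poly_induct2)
  case (pCons c f d g)
  then show ?case by (simp add: eval_pCons const_add r_distr a_ac)
qed simp

lemma eval_scale: "eval t (scale c f) = \<iota> c \<otimes> eval t f"
proof (induction f)
  case (pCons d f)
  have "\<iota> c \<otimes> (t \<otimes> eval t f) = t \<otimes> (\<iota> c \<otimes> eval t f)"
    by (metis const_central const_closed eval_closed m_assoc t)
  with pCons.IH show ?case by (simp add: eval_pCons const_mult r_distr)
qed simp

lemma eval_mult: "eval t (f * g) = eval t f \<otimes> eval t g"
proof (induction f)
  case (pCons c f)
  then show ?case by (simp add: eval_add eval_scale eval_pCons_0 eval_pCons[of c f] l_distr m_assoc)
qed simp

lemma eval_diff: "eval t (f - g) = eval t f \<ominus> eval t g"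
proof -
  have "eval t f = eval t (f - g) \<oplus> eval t g" using eval_add[of "f - g" g] by simp
  then show ?thesis by (metis eval_closed add.inv_solve_right minus_eq)
qed

lemma eval_X: "eval t [:0, 1:] = t"
  by (simp add: eval_pCons const_zero const_one)

lemma eval_pow: "eval t (f ^ n) = eval t f [^] n"
proof (induction n)
  case 0
  then show ?case by (simp add: one_pCons eval_const const_one)
next
  case (Suc n)
  have "eval t (f ^ Suc n) = eval t (f ^ n * f)" by (simp only: power_Suc2)
  then show ?case by (simp add: eval_mult Suc)
qed

end

end

section \<open>Free algebras\<close>

lemma poly_mapping_sum_singles:
  "a = (\<Sum>w\<in>Poly_Mapping.keys a. Poly_Mapping.single w (Poly_Mapping.lookup a w))"
proof (rule poly_mapping_eqI)
  fix k
  have "(\<Sum>w\<in>Poly_Mapping.keys a. Poly_Mapping.lookup a w when w = k) = Poly_Mapping.lookup a k"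
    by (simp add: when_def in_keys_iff)
  then show "Poly_Mapping.lookup a k =
    Poly_Mapping.lookup (\<Sum>w\<in>Poly_Mapping.keys a. Poly_Mapping.single w (Poly_Mapping.lookup a w)) k"
    by (simp add: lookup_sum lookup_single)
qed

lemma poly_mapping_additive_induct [case_names single add]:
  fixes P :: "('w \<Rightarrow>\<^sub>0 'b::comm_monoid_add) \<Rightarrow> bool"
  assumes single: "\<And>w c. P (Poly_Mapping.single w c)" and add: "\<And>a b. P a \<Longrightarrow> P b \<Longrightarrow> P (a + b)"
  shows "P a"
proof -
  have zero: "P 0" using single[of undefined 0] by simp
  have "P (\<Sum>w\<in>A. Poly_Mapping.single w (Poly_Mapping.lookup a w))" if "finite A" for A
    using that by (induction A) (simp_all add: zero single add)
  then show ?thesis by (subst poly_mapping_sum_singles) simp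
qed

lemma free_const_mult_single: "free_const c * Poly_Mapping.single w d = Poly_Mapping.single w (c * d)"
  and single_mult_free_const: "Poly_Mapping.single w d * free_const c = Poly_Mapping.single w (c * d)"
  by (simp_all add: free_const_def mult_single plus_list_def mult.commute)

lemma free_const_central: "free_const c * a = a * free_const c"
  by (induction a rule: poly_mapping_additive_induct)
    (simp_all add: free_const_mult_single single_mult_free_const distrib_left distrib_right)

lemma free_const_0: "free_const 0 = 0"
  and free_const_1: "free_const 1 = 1"
  and free_const_add: "free_const (c + d) = free_const c + free_const d"
  and free_const_mult: "free_const (c * d) = free_const c * free_const d"
  by (simp_all add: free_const_def single_add mult_single plus_list_def)
    (simp flip: zero_list_def)

text \<open>Words arise from a constant by prepending variables, so identities between algebra
  homomorphisms can be checked on generators.\<close>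

lemma free_alg_induct [case_names const var add mult]:
  assumes const: "\<And>c. P (free_const c)" and var: "\<And>v. P (free_var v)"
    and add: "\<And>a b. P a \<Longrightarrow> P b \<Longrightarrow> P (a + b)" and mult: "\<And>a b. P a \<Longrightarrow> P b \<Longrightarrow> P (a * b)"
  shows "P a"
proof (induction a rule: poly_mapping_additive_induct)
  case (single w c)
  show ?case
  proof (induction w)
    case Nil
    then show ?case using const by (simp add: free_const_def)
  next
    case (Cons v w)
    have "Poly_Mapping.single (v # w) c = free_var v * Poly_Mapping.single w c"
      by (simp add: free_var_def mult_single plus_list_def)
    then show ?case using mult var Cons by simp
  qed
qed (rule add)

lemma free_subst_single: "free_subst \<sigma> (Poly_Mapping.single w c) = free_const c * prod_list (map \<sigma> w)"
  by (cases "c = 0") (simp_all add: free_subst_def free_const_0)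

lemma free_subst_add: "free_subst \<sigma> (a + b) = free_subst \<sigma> a + free_subst \<sigma> b"
  unfolding free_subst_def
  by (rule setsum_keys_plus_distrib) (simp_all add: free_const_0 free_const_add distrib_right)

text \<open>Both sides are additive in \<open>a\<close> and in \<open>b\<close>, so monomials
  suffice; \<open>m\<close> stands for the product of the target.\<close>

lemma mult_hom_by_singles:
  fixes \<psi> :: "('v list \<Rightarrow>\<^sub>0 'k::field) \<Rightarrow> 'b::semigroup_add"
  assumes add: "\<And>a b. \<psi> (a + b) = \<psi> a + \<psi> b"
    and l: "\<And>a b c. m (a + b) c = m a c + m b c" and r: "\<And>a b c. m c (a + b) = m c a + m c b"
    and single: "\<And>u w c d. \<psi> (Poly_Mapping.single u c * Poly_Mapping.single w d) =
       m (\<psi> (Poly_Mapping.single u c)) (\<psi> (Poly_Mapping.single w d))"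
  shows "\<psi> (a * b) = m (\<psi> a) (\<psi> b)"
proof (induction a rule: poly_mapping_additive_induct)
  case (single u c)
  show ?case
  proof (induction b rule: poly_mapping_additive_induct)
    case (add a b)
    then show ?case by (simp only: distrib_left assms(1) r)
  qed (rule assms(4))
next
  case (add a b)
  then show ?case by (simp only: distrib_right assms(1) l)
qed

lemma free_subst_mult: "free_subst \<sigma> (a * b) = free_subst \<sigma> a * free_subst \<sigma> b"
proof (rule mult_hom_by_singles[of _ "(*)"])
  fix u w :: "'a list" and c d :: 'b
  \<comment> \<open>The coefficient \<open>d\<close> is moved past the images of the letters of
    \<open>u\<close>, constants being central.\<close>
  have "free_const (c * d) * (prod_list (map \<sigma> u) * prod_list (map \<sigma> w)) =
    free_const c * (prod_list (map \<sigma> u) * free_const d) * prod_list (map \<sigma> w)"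
    unfolding free_const_central[of d, symmetric] by (simp add: free_const_mult mult.assoc)
  then show "free_subst \<sigma> (Poly_Mapping.single u c * Poly_Mapping.single w d) =
      free_subst \<sigma> (Poly_Mapping.single u c) * free_subst \<sigma> (Poly_Mapping.single w d)"
    by (simp add: free_subst_single mult_single plus_list_def mult.assoc)
qed (simp_all add: free_subst_add distrib_left distrib_right)

lemma free_subst_const: "free_subst \<sigma> (free_const c) = free_const c"
  using free_subst_single[of \<sigma> "[]" c] by (simp add: free_const_def)

lemma free_subst_var: "free_subst \<sigma> (free_var v) = \<sigma> v"
  using free_subst_single[of \<sigma> "[v]" 1] by (simp add: free_var_def free_const_1)

lemma E_act_add: "E_act g (a + b) = E_act g a + E_act g b"
  and E_act_mult: "E_act g (a * b) = E_act g a * E_act g b"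
  and E_act_const: "E_act g (free_const c) = free_const c"
  and E_act_X: "E_act g (free_var GenX) = free_var GenX"
  and E_act_Y: "E_act g (free_var GenY) = free_var GenY + free_const (g $ 1 $ 2) * free_var GenX"
  by (simp_all add: E_act_def free_subst_add free_subst_mult free_subst_const free_subst_var)

lemma unip_12 [simp]: "unip a $ 1 $ 2 = a"
  by (simp add: unip_def)

lemma unip_mult: "unip a ** unip b = unip (a + b)"
  by (simp add: unip_def matrix_matrix_mult_def vec_eq_iff forall_2 sum_2)

lemma unip_0: "unip 0 = mat 1"
  by (simp add: unip_def mat_def vec_eq_iff forall_2)

lemma unip_inject [simp]: "unip a = unip b \<longleftrightarrow> a = b"
  by (metis unip_12)

text \<open>Both sides are algebra homomorphisms; both fix \<open>x\<close> and send
  \<open>y\<close> to \<open>y + (a + b) x\<close>.\<close>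

lemma E_act_unip_add: "E_act (unip (a + b)) f = E_act (unip a) (E_act (unip b) f)"
proof (induction f rule: free_alg_induct)
  case (var v)
  show ?case
    by (cases v) (simp_all add: E_act_X E_act_Y E_act_add E_act_mult E_act_const free_const_add
        distrib_right)
qed (simp_all add: E_act_const E_act_add E_act_mult)

lemma E_act_unip_0: "E_act (unip 0) f = f"
proof (induction f rule: free_alg_induct)
  case (var v)
  show ?case by (cases v) (simp_all add: E_act_X E_act_Y free_const_0)
qed (simp_all add: E_act_const E_act_add E_act_mult)

section \<open>Smash products\<close>

locale smash_action = group G for G (structure) +
  fixes \<alpha> :: "'g \<Rightarrow> 'a::ring_1 \<Rightarrow> 'a"
  assumes fin: "finite (carrier G)"
    and act_add: "u \<in> carrier G \<Longrightarrow> \<alpha> u (a + b) = \<alpha> u a + \<alpha> u b"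
    and act_mult: "u \<in> carrier G \<Longrightarrow> \<alpha> u (a * b) = \<alpha> u a * \<alpha> u b"
    and act_1: "u \<in> carrier G \<Longrightarrow> \<alpha> u 1 = 1"
    and act_comp: "u \<in> carrier G \<Longrightarrow> w \<in> carrier G \<Longrightarrow> \<alpha> (u \<otimes> w) a = \<alpha> u (\<alpha> w a)"
    and act_one: "\<alpha> \<one> a = a"
begin

abbreviation "S \<equiv> smash_product G \<alpha>"

lemma act_zero: "u \<in> carrier G \<Longrightarrow> \<alpha> u 0 = 0"
  using act_add[of u 0 0] by simp

lemma act_sum: "u \<in> carrier G \<Longrightarrow> \<alpha> u (sum f A) = (\<Sum>i\<in>A. \<alpha> u (f i))"
  by (induction A rule: infinite_finite_induct) (simp_all add: act_zero act_add)

lemma smash_carrier: "carrier S = carrier G \<rightarrow>\<^sub>E UNIV"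
  and smash_add: "f \<oplus>\<^bsub>S\<^esub> h = (\<lambda>g\<in>carrier G. f g + h g)"
  and smash_zero: "\<zero>\<^bsub>S\<^esub> = (\<lambda>g\<in>carrier G. 0)"
  by (simp_all add: smash_product_def)

lemma smash_mult: "f \<otimes>\<^bsub>S\<^esub> h = (\<lambda>g\<in>carrier G. \<Sum>u\<in>carrier G. f u * \<alpha> u (h (inv u \<otimes> g)))"
  by (simp add: smash_product_def)

lemma smash_one: "\<one>\<^bsub>S\<^esub> = smash_single G 1 \<one>"
  by (simp add: smash_product_def smash_single_def fun_eq_iff)

lemma sum_translate:
  assumes t: "t \<in> carrier G"
  shows "(\<Sum>u\<in>carrier G. f u) = (\<Sum>w\<in>carrier G. f (t \<otimes> w))"
  by (rule sum.reindex_bij_witness[of _ "\<lambda>w. t \<otimes> w" "\<lambda>u. inv t \<otimes> u"])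
    (use t in \<open>auto simp: m_assoc[symmetric]\<close>)

text \<open>After interchanging the sums, the substitution \<open>u = t \<otimes> w\<close> and
  \<open>\<alpha> (t \<otimes> w) a = \<alpha> t (\<alpha> w a)\<close> match the two sides.\<close>

lemma smash_assoc:
  "f \<otimes>\<^bsub>S\<^esub> h \<otimes>\<^bsub>S\<^esub> k = f \<otimes>\<^bsub>S\<^esub> (h \<otimes>\<^bsub>S\<^esub> k)"
proof -
  have "(\<Sum>u\<in>carrier G. (\<Sum>t\<in>carrier G. f t * \<alpha> t (h (inv t \<otimes> u))) * \<alpha> u (k (inv u \<otimes> g)))
    = (\<Sum>t\<in>carrier G. f t * \<alpha> t (\<Sum>w\<in>carrier G. h w * \<alpha> w (k (inv w \<otimes> (inv t \<otimes> g)))))"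
    (is "?l = ?r") if g: "g \<in> carrier G" for g
  proof -
    have "?l = (\<Sum>t\<in>carrier G. \<Sum>u\<in>carrier G. f t * \<alpha> t (h (inv t \<otimes> u)) * \<alpha> u (k (inv u \<otimes> g)))"
      unfolding sum_distrib_right by (rule sum.swap)
    also have "\<dots> = (\<Sum>t\<in>carrier G. \<Sum>w\<in>carrier G.
        f t * \<alpha> t (h w) * \<alpha> t (\<alpha> w (k (inv w \<otimes> (inv t \<otimes> g)))))"
    proof (rule sum.cong[OF refl])
      fix t assume t: "t \<in> carrier G"
      show "(\<Sum>u\<in>carrier G. f t * \<alpha> t (h (inv t \<otimes> u)) * \<alpha> u (k (inv u \<otimes> g))) =
        (\<Sum>w\<in>carrier G. f t * \<alpha> t (h w) * \<alpha> t (\<alpha> w (k (inv w \<otimes> (inv t \<otimes> g)))))"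
        unfolding sum_translate[OF t, of "\<lambda>u. f t * \<alpha> t (h (inv t \<otimes> u)) * \<alpha> u (k (inv u \<otimes> g))"]
        using t g by (intro sum.cong) (simp_all add: act_comp inv_mult_group m_assoc[symmetric])
    qed
    also have "\<dots> = ?r"
      by (intro sum.cong refl) (simp add: act_sum act_mult sum_distrib_left mult.assoc)
    finally show ?thesis .
  qed
  then show ?thesis by (auto simp: smash_mult restrict_def fun_eq_iff cong: sum.cong)
qed

lemma smash_single_closed [simp, intro]: "smash_single G a u \<in> carrier S"
  by (simp add: smash_single_def smash_carrier)

lemma smash_single_mult_left:
  assumes u: "u \<in> carrier G" and g: "g \<in> carrier G"
  shows "(smash_single G a u \<otimes>\<^bsub>S\<^esub> f) g = a * \<alpha> u (f (inv u \<otimes> g))"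
proof -
  have "(\<Sum>t\<in>carrier G. smash_single G a u t * \<alpha> t (f (inv t \<otimes> g))) =
     (\<Sum>t\<in>carrier G. if t = u then a * \<alpha> u (f (inv u \<otimes> g)) else 0)"
    by (intro sum.cong) (auto simp: smash_single_def)
  then show ?thesis using u g fin by (simp add: smash_mult sum.delta)
qed

lemma smash_single_mult:
  assumes "u \<in> carrier G" "w \<in> carrier G"
  shows "smash_single G a u \<otimes>\<^bsub>S\<^esub> smash_single G b w = smash_single G (a * \<alpha> u b) (u \<otimes> w)"
proof -
  have "(smash_single G a u \<otimes>\<^bsub>S\<^esub> smash_single G b w) g = smash_single G (a * \<alpha> u b) (u \<otimes> w) g"
    if g: "g \<in> carrier G" for g
  proof -
    have "inv u \<otimes> g = w \<longleftrightarrow> g = u \<otimes> w" using assms g by (metis inv_solve_left)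
    then show ?thesis
      using assms g by (simp add: smash_single_mult_left) (simp add: smash_single_def act_zero)
  qed
  then show ?thesis
    by (auto simp: fun_eq_iff) (auto simp: smash_mult smash_single_def)
qed

lemma smash_single_add:
  "smash_single G a u \<oplus>\<^bsub>S\<^esub> smash_single G b u = smash_single G (a + b) u"
  by (auto simp: smash_add smash_single_def fun_eq_iff restrict_def)

lemma smash_ring: "ring S"
proof (intro ringI abelian_groupI monoidI)
  fix f assume f: "f \<in> carrier S"
  show "\<exists>h\<in>carrier S. h \<oplus>\<^bsub>S\<^esub> f = \<zero>\<^bsub>S\<^esub>"
    by (rule bexI[of _ "\<lambda>g\<in>carrier G. - f g"])
      (auto simp: smash_carrier smash_add smash_zero fun_eq_iff restrict_def)
  show "\<zero>\<^bsub>S\<^esub> \<oplus>\<^bsub>S\<^esub> f = f"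
    using f by (auto simp: smash_carrier smash_add smash_zero fun_eq_iff restrict_def PiE_def
        extensional_def)
  show "\<one>\<^bsub>S\<^esub> \<otimes>\<^bsub>S\<^esub> f = f"
  proof
    fix g show "(\<one>\<^bsub>S\<^esub> \<otimes>\<^bsub>S\<^esub> f) g = f g"
    proof (cases "g \<in> carrier G")
      case True
      then show ?thesis by (simp add: smash_one smash_single_mult_left act_one)
    qed (use f in \<open>auto simp: smash_mult smash_carrier\<close>)
  qed
  show "f \<otimes>\<^bsub>S\<^esub> \<one>\<^bsub>S\<^esub> = f"
  proof
    fix g show "(f \<otimes>\<^bsub>S\<^esub> \<one>\<^bsub>S\<^esub>) g = f g"
    proof (cases "g \<in> carrier G")
      case True
      have "(\<Sum>u\<in>carrier G. f u * \<alpha> u (\<one>\<^bsub>S\<^esub> (inv u \<otimes> g))) = (\<Sum>u\<in>carrier G. if u = g then f g else 0)"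
      proof (rule sum.cong[OF refl])
        fix u assume u: "u \<in> carrier G"
        have "inv u \<otimes> g = \<one> \<longleftrightarrow> u = g" using u True by (metis inv_solve_left one_closed r_one)
        then show "f u * \<alpha> u (\<one>\<^bsub>S\<^esub> (inv u \<otimes> g)) = (if u = g then f g else 0)"
          using u True by (simp add: smash_one smash_single_def act_1 act_zero)
      qed
      then show ?thesis using True fin by (simp add: smash_mult sum.delta)
    qed (use f in \<open>auto simp: smash_mult smash_carrier\<close>)
  qed
next
  fix f h k
  show "(f \<oplus>\<^bsub>S\<^esub> h) \<otimes>\<^bsub>S\<^esub> k = f \<otimes>\<^bsub>S\<^esub> k \<oplus>\<^bsub>S\<^esub> h \<otimes>\<^bsub>S\<^esub> k"
    by (auto simp: smash_mult smash_add fun_eq_iff restrict_def distrib_right sum.distrib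
        cong: sum.cong)
  show "k \<otimes>\<^bsub>S\<^esub> (f \<oplus>\<^bsub>S\<^esub> h) = k \<otimes>\<^bsub>S\<^esub> f \<oplus>\<^bsub>S\<^esub> k \<otimes>\<^bsub>S\<^esub> h"
    by (auto simp: smash_mult smash_add fun_eq_iff restrict_def distrib_left act_add sum.distrib
        cong: sum.cong)
qed (auto simp: smash_assoc, auto simp: smash_carrier smash_add smash_zero smash_mult smash_one
    smash_single_def fun_eq_iff restrict_def add_ac)

lemma smash_induct [consumes 1, case_names single add]:
  assumes f: "f \<in> carrier S"
    and single: "\<And>a u. u \<in> carrier G \<Longrightarrow> P (smash_single G a u)"
    and add: "\<And>f h. f \<in> carrier S \<Longrightarrow> h \<in> carrier S \<Longrightarrow> P f \<Longrightarrow> P h \<Longrightarrow> P (f \<oplus>\<^bsub>S\<^esub> h)"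
  shows "P f"
proof -
  \<comment> \<open>The truncation of \<open>f\<close> to \<open>A\<close> gains one single term
    with each insertion; the empty truncation is a single term with coefficient 0.\<close>
  have "P (\<lambda>g\<in>carrier G. if g \<in> A then f g else 0)" if "finite A" "A \<subseteq> carrier G" for A
    using that
  proof (induction A)
    case empty
    have "(\<lambda>g\<in>carrier G. if g \<in> {} then f g else 0) = smash_single G 0 \<one>"
      by (auto simp: smash_single_def)
    then show ?case using single[OF one_closed] by metis
  next
    case (insert u A)
    let ?f = "\<lambda>g\<in>carrier G. if g \<in> A then f g else 0"
    have e: "(\<lambda>g\<in>carrier G. if g \<in> insert u A then f g else 0) = smash_single G (f u) u \<oplus>\<^bsub>S\<^esub> ?f"
      using insert.hyps by (auto simp: smash_add smash_single_def fun_eq_iff restrict_def)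
    have "?f \<in> carrier S" by (simp add: smash_carrier)
    moreover have "P ?f" using insert.IH insert.prems by blast
    ultimately show ?case
      unfolding e using insert.prems by (intro add single smash_single_closed) auto
  qed
  from this[OF fin] have "P (\<lambda>g\<in>carrier G. if g \<in> carrier G then f g else 0)" by simp
  also have "(\<lambda>g\<in>carrier G. if g \<in> carrier G then f g else 0) = f"
    using f by (auto simp: smash_carrier fun_eq_iff restrict_def PiE_def extensional_def)
  finally show ?thesis .
qed

end

section \<open>Generators and relations of the algebra $H_{g_1}$\<close>

lemma (in abelian_group) diff_diff_zero_imp_eq:
  assumes "a \<in> carrier G" "b \<in> carrier G" "c \<in> carrier G" "a \<ominus> b \<ominus> c = \<zero>"
  shows "a = b \<oplus> c"
proof -
  have "a \<ominus> b = c"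
    using assms add.inv_solve_right[of \<zero> "a \<ominus> b" c] by (simp add: minus_eq)
  then have "a = c \<oplus> b"
    using assms add.inv_solve_right[of c a b] by (simp add: minus_eq)
  then show ?thesis using assms by (simp add: a_comm)
qed

text \<open>E is isomorphic to the additive group of \<open>F\<close>, so \<open>F\<close> is
  recorded as a finite additive subgroup of k containing 1.\<close>

locale H_setting = odd_char p K for p and K :: "'k::alg_closed_field itself" +
  fixes F :: "'k set"
  assumes finite_F: "finite F" and zero_F: "0 \<in> F" and one_F: "1 \<in> F"
    and add_F: "a \<in> F \<Longrightarrow> b \<in> F \<Longrightarrow> a + b \<in> F" and minus_F: "a \<in> F \<Longrightarrow> - a \<in> F"
begin

lemma E_carrier: "carrier (E_group F) = unip ` F"
  and E_mult: "u \<otimes>\<^bsub>E_group F\<^esub> w = u ** w"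
  and E_one: "\<one>\<^bsub>E_group F\<^esub> = unip 0"
  by (simp_all add: E_group_def unip_0)

lemma E_is_group: "group (E_group F)"
proof (rule groupI)
  fix u assume "u \<in> carrier (E_group F)"
  then obtain a where "a \<in> F" "u = unip a" by (auto simp: E_carrier)
  then show "\<exists>w\<in>carrier (E_group F). w \<otimes>\<^bsub>E_group F\<^esub> u = \<one>\<^bsub>E_group F\<^esub>"
    by (intro bexI[of _ "unip (- a)"]) (auto simp: E_carrier E_mult E_one unip_mult minus_F)
qed (auto simp: E_carrier E_mult E_one unip_mult add_F zero_F add.assoc)

lemma smash_action: "smash_action (E_group F) E_act"
proof (intro smash_action.intro smash_action_axioms.intro E_is_group)
  fix u w a assume "u \<in> carrier (E_group F)" "w \<in> carrier (E_group F)"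
  then show "E_act (u \<otimes>\<^bsub>E_group F\<^esub> w) a = E_act u (E_act w a)"
    by (auto simp: E_carrier E_mult unip_mult E_act_unip_add)
next
  fix u show "E_act u 1 = 1" using E_act_const[of u 1] by (simp add: free_const_1)
qed (simp_all add: E_carrier finite_F E_act_add E_act_mult E_one E_act_unip_0)

end

context H_setting
begin

interpretation sm: smash_action "E_group F" E_act
  by (rule smash_action)

interpretation S: ring "smash F"
  using sm.smash_ring by (simp add: smash_def)

lemmas smash_single_closed [simp, intro] = sm.smash_single_closed[folded smash_def]
  and smash_single_add = sm.smash_single_add[folded smash_def]
  and smash_induct = sm.smash_induct[folded smash_def, consumes 1, case_names single add]

lemma smash_single_mult:
  assumes "a \<in> F" "b \<in> F"
  shows "smash_single (E_group F) f (unip a) \<otimes>\<^bsub>smash F\<^esub> smash_single (E_group F) h (unip b) =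
    smash_single (E_group F) (f * E_act (unip a) h) (unip (a + b))"
  using sm.smash_single_mult[of "unip a" "unip b" f h] assms
  by (simp add: smash_def E_carrier E_mult unip_mult)

lemma of_alg_closed [simp, intro]: "of_alg F f \<in> carrier (smash F)"
  and of_grp_closed [simp, intro]: "of_grp F u \<in> carrier (smash F)"
  by (simp_all add: of_alg_def of_grp_def)

lemma of_alg_unip: "of_alg F f = smash_single (E_group F) f (unip 0)"
  by (simp add: of_alg_def unip_0)

lemma of_alg_add: "of_alg F (f + h) = of_alg F f \<oplus>\<^bsub>smash F\<^esub> of_alg F h"
  by (simp add: of_alg_def smash_single_add)

lemma of_alg_mult: "of_alg F (f * h) = of_alg F f \<otimes>\<^bsub>smash F\<^esub> of_alg F h"
  by (simp add: of_alg_unip smash_single_mult zero_F E_act_unip_0)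

lemma of_alg_1: "of_alg F 1 = \<one>\<^bsub>smash F\<^esub>"
  by (simp add: of_alg_def smash_def sm.smash_one E_one unip_0)

lemma of_alg_minus: "of_alg F (f - h) = of_alg F f \<ominus>\<^bsub>smash F\<^esub> of_alg F h"
proof -
  have "of_alg F f = of_alg F (f - h) \<oplus>\<^bsub>smash F\<^esub> of_alg F h"
    using of_alg_add[of "f - h" h] by simp
  then show ?thesis by (metis S.add.inv_solve_right S.minus_eq of_alg_closed)
qed

lemma of_grp_mult:
  "a \<in> F \<Longrightarrow> b \<in> F \<Longrightarrow> of_grp F (unip a) \<otimes>\<^bsub>smash F\<^esub> of_grp F (unip b) = of_grp F (unip (a + b))"
  using E_act_const[of "unip a" 1] by (simp add: of_grp_def smash_single_mult free_const_1)

lemma of_grp_0: "of_grp F (unip 0) = \<one>\<^bsub>smash F\<^esub>"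
  using of_alg_1 by (simp add: of_grp_def of_alg_unip)

lemma of_alg_of_grp:
  "a \<in> F \<Longrightarrow> of_alg F f \<otimes>\<^bsub>smash F\<^esub> of_grp F (unip a) = smash_single (E_group F) f (unip a)"
  by (simp add: of_alg_unip of_grp_def smash_single_mult zero_F E_act_unip_0)

lemma of_grp_of_alg:
  "a \<in> F \<Longrightarrow> of_grp F (unip a) \<otimes>\<^bsub>smash F\<^esub> of_alg F f =
    of_alg F (E_act (unip a) f) \<otimes>\<^bsub>smash F\<^esub> of_grp F (unip a)"
  by (simp add: of_alg_of_grp) (simp add: of_alg_unip of_grp_def smash_single_mult zero_F)

lemma H_relation_closed: "H_relation F \<in> carrier (smash F)"
  by (simp add: H_relation_def)

interpretation I: ideal "H_ideal F" "smash F"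
  unfolding H_ideal_def using S.genideal_ideal H_relation_closed by simp

interpretation H: ring "H_alg F"
  unfolding H_alg_def by (rule I.quotient_is_ring)

section \<open>The quotient map to H and the relations between the generators\<close>

abbreviation cls :: "'k smash_elt \<Rightarrow> 'k smash_elt set" where
  "cls f \<equiv> H_ideal F +>\<^bsub>smash F\<^esub> f"

lemma cls_hom: "cls \<in> ring_hom (smash F) (H_alg F)"
  unfolding H_alg_def by (rule I.rcos_ring_hom)

lemmas cls_closed [simp, intro] = ring_hom_closed[OF cls_hom]
  and cls_mult [simp] = ring_hom_mult[OF cls_hom]
  and cls_add [simp] = ring_hom_add[OF cls_hom]
  and cls_one [simp] = ring_hom_one[OF cls_hom]

lemma cls_minus [simp]:
  assumes "f \<in> carrier (smash F)" "h \<in> carrier (smash F)"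
  shows "cls (f \<ominus>\<^bsub>smash F\<^esub> h) = cls f \<ominus>\<^bsub>H_alg F\<^esub> cls h"
proof -
  have "cls f = cls (f \<ominus>\<^bsub>smash F\<^esub> h) \<oplus>\<^bsub>H_alg F\<^esub> cls h"
    using assms S.add.inv_solve_right[of "f \<ominus>\<^bsub>smash F\<^esub> h" f h] by (simp add: S.minus_eq flip: cls_add)
  then show ?thesis
    using assms H.add.inv_solve_right[of "cls (f \<ominus>\<^bsub>smash F\<^esub> h)" "cls f" "cls h"]
    by (simp add: H.minus_eq)
qed

lemma H_carrier: "carrier (H_alg F) = cls ` carrier (smash F)"
proof -
  have "carrier (H_alg F) = a_rcosets\<^bsub>smash F\<^esub> (H_ideal F)"
    by (simp only: H_alg_def FactRing_def partial_object.select_convs)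
  then show ?thesis unfolding A_RCOSETS_def' by (simp only: UNION_singleton_eq_range)
qed

lemma generators_closed [simp, intro]:
  "x_H F \<in> carrier (H_alg F)" "y_H F \<in> carrier (H_alg F)" "grp_H F u \<in> carrier (H_alg F)"
  "const_H F c \<in> carrier (H_alg F)"
  by (simp_all add: x_H_def y_H_def grp_H_def const_H_def)

text \<open>A smash element is a sum of products \<open>a u\<close> with \<open>a\<close> in the
  free algebra and \<open>u\<close> in E, so its class is built from these generators. Stability of
  a subset of a module under H then reduces to generators.\<close>

lemma H_induct [consumes 1, case_names const x y grp add mult]:
  assumes h: "h \<in> carrier (H_alg F)"
    and const: "\<And>c. P (const_H F c)" and x: "P (x_H F)" and y: "P (y_H F)"
    and grp: "\<And>a. a \<in> F \<Longrightarrow> P (grp_H F (unip a))"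
    and add: "\<And>h h'. h \<in> carrier (H_alg F) \<Longrightarrow> h' \<in> carrier (H_alg F) \<Longrightarrow> P h \<Longrightarrow> P h' \<Longrightarrow>
      P (h \<oplus>\<^bsub>H_alg F\<^esub> h')"
    and mult: "\<And>h h'. h \<in> carrier (H_alg F) \<Longrightarrow> h' \<in> carrier (H_alg F) \<Longrightarrow> P h \<Longrightarrow> P h' \<Longrightarrow>
      P (h \<otimes>\<^bsub>H_alg F\<^esub> h')"
  shows "P h"
proof -
  have alg: "P (cls (of_alg F f))" for f
  proof (induction f rule: free_alg_induct)
    case (const c)
    then show ?case using assms(2) by (simp add: const_H_def)
  next
    case (var v)
    then show ?case using x y by (cases v) (simp_all add: x_H_def y_H_def)
  qed (simp_all add: of_alg_add of_alg_mult assms(6,7))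
  obtain f where f: "f \<in> carrier (smash F)" "h = cls f" using h by (auto simp: H_carrier)
  from f(1) have "P (cls f)"
  proof (induction f rule: smash_induct)
    case (single f u)
    then obtain a where a: "a \<in> F" "u = unip a" by (auto simp: E_carrier)
    have "P (cls (of_alg F f) \<otimes>\<^bsub>H_alg F\<^esub> grp_H F (unip a))"
      using a alg grp mult by (simp add: grp_H_def)
    then show ?case using a by (simp add: grp_H_def flip: of_alg_of_grp)
  qed (simp add: add)
  then show ?thesis using f by simp
qed

lemma cls_relation: "cls (H_relation F) = \<zero>\<^bsub>H_alg F\<^esub>"
proof -
  have "H_relation F \<in> H_ideal F"
    unfolding H_ideal_def using S.genideal_self' H_relation_closed by blast
  then have "cls (H_relation F) = H_ideal F"
    by (rule S.a_coset_join2[OF H_relation_closed I.a_subgroup])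
  then show ?thesis by (simp only: H_alg_def FactRing_def ring_record_simps)
qed

lemma x_y: "x_H F \<otimes>\<^bsub>H_alg F\<^esub> y_H F = y_H F \<otimes>\<^bsub>H_alg F\<^esub> x_H F \<oplus>\<^bsub>H_alg F\<^esub> grp_H F (unip 1)"
proof -
  have "(x_H F \<otimes>\<^bsub>H_alg F\<^esub> y_H F \<ominus>\<^bsub>H_alg F\<^esub> y_H F \<otimes>\<^bsub>H_alg F\<^esub> x_H F)
      \<ominus>\<^bsub>H_alg F\<^esub> grp_H F (unip 1) = \<zero>\<^bsub>H_alg F\<^esub>"
    unfolding cls_relation[symmetric] H_relation_def x_H_def y_H_def grp_H_def of_alg_minus of_alg_mult
    by simp
  then show ?thesis
    by (rule H.diff_diff_zero_imp_eq[rotated 3]) (rule H.m_closed generators_closed)+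
qed

lemma grp_x: "a \<in> F \<Longrightarrow> grp_H F (unip a) \<otimes>\<^bsub>H_alg F\<^esub> x_H F = x_H F \<otimes>\<^bsub>H_alg F\<^esub> grp_H F (unip a)"
  by (simp add: x_H_def grp_H_def of_grp_of_alg E_act_X flip: cls_mult)

lemma grp_y: "a \<in> F \<Longrightarrow> grp_H F (unip a) \<otimes>\<^bsub>H_alg F\<^esub> y_H F =
    (y_H F \<oplus>\<^bsub>H_alg F\<^esub> const_H F a \<otimes>\<^bsub>H_alg F\<^esub> x_H F) \<otimes>\<^bsub>H_alg F\<^esub> grp_H F (unip a)"
  by (simp add: x_H_def y_H_def const_H_def grp_H_def of_grp_of_alg E_act_Y of_alg_add of_alg_mult
      flip: cls_mult cls_add)

lemma grp_grp: "a \<in> F \<Longrightarrow> b \<in> F \<Longrightarrow>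
    grp_H F (unip a) \<otimes>\<^bsub>H_alg F\<^esub> grp_H F (unip b) = grp_H F (unip (a + b))"
  by (simp add: grp_H_def of_grp_mult flip: cls_mult)

lemma grp_0: "grp_H F (unip 0) = \<one>\<^bsub>H_alg F\<^esub>"
  by (simp add: grp_H_def of_grp_0)

lemma const_H_1: "const_H F 1 = \<one>\<^bsub>H_alg F\<^esub>"
  by (simp add: const_H_def free_const_1 of_alg_1)

lemma const_H_mult: "const_H F (c * d) = const_H F c \<otimes>\<^bsub>H_alg F\<^esub> const_H F d"
  by (simp add: const_H_def free_const_mult of_alg_mult)

lemma const_H_add: "const_H F (c + d) = const_H F c \<oplus>\<^bsub>H_alg F\<^esub> const_H F d"
  by (simp add: const_H_def free_const_add of_alg_add)

text \<open>Induction over generators; group elements commute with constants because E fixes the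
  latter.\<close>

lemma const_H_central:
  assumes "h \<in> carrier (H_alg F)"
  shows "const_H F c \<otimes>\<^bsub>H_alg F\<^esub> h = h \<otimes>\<^bsub>H_alg F\<^esub> const_H F c"
  using assms
proof (induction h rule: H_induct)
  case (const d)
  then show ?case by (metis const_H_mult mult.commute)
next
  case x
  then show ?case
    by (simp add: const_H_def x_H_def free_const_central flip: cls_mult of_alg_mult)
next
  case y
  then show ?case
    by (simp add: const_H_def y_H_def free_const_central flip: cls_mult of_alg_mult)
next
  case (grp a)
  then show ?case
    by (simp add: const_H_def grp_H_def of_grp_of_alg E_act_const flip: cls_mult)
next
  case (add h h')
  then show ?case by (simp add: H.l_distr H.r_distr)
next
  case (mult h h')
  then show ?case by (metis H.m_assoc generators_closed(4))
qed

lemma ring_over_field: "ring_over_field (H_alg F) (const_H F)"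
  by (intro ring_over_field.intro ring_over_field_axioms.intro H.ring_axioms generators_closed(4)
    const_H_add const_H_mult const_H_1 const_H_central)

end

section \<open>The representation on polynomials\<close>

definition word_op :: "gen list \<Rightarrow> 'k::field poly \<Rightarrow> 'k poly" where
  "word_op w = foldr (\<lambda>v. case v of GenX \<Rightarrow> X_op | GenY \<Rightarrow> pCons 0) w"

definition alg_op :: "'k::field free_alg \<Rightarrow> 'k poly \<Rightarrow> 'k poly" where
  "alg_op a l = (\<Sum>w\<in>Poly_Mapping.keys a. scale (Poly_Mapping.lookup a w) (word_op w l))"

text \<open>In the term \<open>f(g_a) g_a\<close> the group element stands on the right, hence acts
  first.\<close>

definition smash_op :: "'k::field set \<Rightarrow> 'k smash_elt \<Rightarrow> 'k poly \<Rightarrow> 'k poly" where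
  "smash_op F f l = (\<Sum>a\<in>F. alg_op (f (unip a)) (G_op a l))"

lemma word_op_add: "word_op w (l + l') = word_op w l + word_op w l'"
  by (induction w) (auto simp: word_op_def X_op_add split: gen.split)

lemma word_op_scale: "word_op w (scale c l) = scale c (word_op w l)"
  by (induction w) (auto simp: word_op_def X_op_smult split: gen.split)

lemma word_op_append: "word_op (u @ w) l = word_op u (word_op w l)"
  by (simp add: word_op_def)

lemma alg_op_single: "alg_op (Poly_Mapping.single w c) l = scale c (word_op w l)"
  by (cases "c = 0") (simp_all add: alg_op_def)

lemma alg_op_add_left: "alg_op (a + b) l = alg_op a l + alg_op b l"
  unfolding alg_op_def by (rule setsum_keys_plus_distrib) (simp_all add: smult_add_left)

lemma alg_op_add_right: "alg_op a (l + l') = alg_op a l + alg_op a l'"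
  by (simp add: alg_op_def word_op_add smult_add_right sum.distrib)

lemma alg_op_0: "alg_op 0 l = 0"
  by (simp add: alg_op_def)

lemma alg_op_minus: "alg_op (a - b) l = alg_op a l - alg_op b l"
  using alg_op_add_left[of "a - b" b l] by simp

lemma alg_op_0_right: "alg_op a 0 = 0"
  using alg_op_add_right[of a 0 0] by (metis add.right_neutral add_left_imp_eq)

lemma alg_op_sum_right: "alg_op a (\<Sum>i\<in>A. l i) = (\<Sum>i\<in>A. alg_op a (l i))"
  by (induction A rule: infinite_finite_induct) (simp_all add: alg_op_0_right alg_op_add_right)

lemma alg_op_sum_left: "alg_op (\<Sum>i\<in>A. f i) l = (\<Sum>i\<in>A. alg_op (f i) l)"
  by (induction A rule: infinite_finite_induct) (simp_all add: alg_op_0 alg_op_add_left)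

lemma alg_op_mult: "alg_op (a * b) l = alg_op a (alg_op b l)"
proof (induction a rule: poly_mapping_additive_induct)
  case (single u c)
  show ?case
  proof (induction b rule: poly_mapping_additive_induct)
    case (single w d)
    show ?case
      by (simp add: mult_single plus_list_def alg_op_single word_op_append word_op_scale)
  next
    case (add a b)
    then show ?case by (simp only: distrib_left alg_op_add_left alg_op_add_right)
  qed
next
  case (add a b)
  then show ?case by (simp only: distrib_right alg_op_add_left)
qed

lemma alg_op_const: "alg_op (free_const c) l = scale c l"
  and alg_op_X: "alg_op (free_var GenX) l = X_op l"
  and alg_op_Y: "alg_op (free_var GenY) l = pCons 0 l"
  by (simp_all add: free_const_def free_var_def alg_op_single word_op_def)

text \<open>The covariance that a representation of the smash product requires. On \<open>x\<close>
  and \<open>y\<close> it is \<open>G_op_X_op\<close> and \<open>G_op_pCons\<close>, and it passes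
  to sums and products.\<close>

lemma G_op_alg_op: "G_op a (alg_op f l) = alg_op (E_act (unip a) f) (G_op a l)"
proof (induction f arbitrary: l rule: free_alg_induct)
  case (const c)
  show ?case by (simp add: E_act_const alg_op_const G_op_smult)
next
  case (var v)
  show ?case
    by (cases v) (simp_all add: E_act_X E_act_Y alg_op_X alg_op_Y G_op_X_op G_op_pCons
        alg_op_add_left alg_op_mult alg_op_const)
next
  case (add f h)
  then show ?case by (simp add: E_act_add alg_op_add_left G_op_add)
next
  case (mult f h)
  then show ?case by (simp add: E_act_mult alg_op_mult)
qed

lemma G_op_sum: "G_op a (\<Sum>i\<in>A. l i) = (\<Sum>i\<in>A. G_op a (l i))"
  by (induction A rule: infinite_finite_induct) (simp_all add: G_op_add)

section \<open>The action of the smash product on k[y] and its descent to H\<close>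

context H_setting
begin

interpretation sm: smash_action "E_group F" E_act
  by (rule smash_action)

interpretation S: ring "smash F"
  using sm.smash_ring by (simp add: smash_def)

lemma smash_add_unip:
  "a \<in> F \<Longrightarrow> (f \<oplus>\<^bsub>smash F\<^esub> h) (unip a) = f (unip a) + h (unip a)"
  by (simp add: smash_def sm.smash_add E_carrier)

lemma E_inv_mult:
  assumes "a \<in> F" "b \<in> F"
  shows "inv\<^bsub>E_group F\<^esub> unip a \<otimes>\<^bsub>E_group F\<^esub> unip b = unip (b - a)"
proof -
  have "inv\<^bsub>E_group F\<^esub> unip a = unip (- a)"
    by (rule sm.inv_equality) (use assms in \<open>auto simp: E_carrier E_mult E_one unip_mult minus_F\<close>)
  then show ?thesis by (simp add: E_mult unip_mult)
qed

lemma smash_mult_unip: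
  assumes "b \<in> F"
  shows "(f \<otimes>\<^bsub>smash F\<^esub> h) (unip b) = (\<Sum>a\<in>F. f (unip a) * E_act (unip a) (h (unip (b - a))))"
proof -
  have "(f \<otimes>\<^bsub>smash F\<^esub> h) (unip b) = (\<Sum>u\<in>unip ` F.
      f u * E_act u (h (inv\<^bsub>E_group F\<^esub> u \<otimes>\<^bsub>E_group F\<^esub> unip b)))"
    using assms by (simp add: smash_def sm.smash_mult E_carrier)
  also have "\<dots> = (\<Sum>a\<in>F. f (unip a) * E_act (unip a)
      (h (inv\<^bsub>E_group F\<^esub> unip a \<otimes>\<^bsub>E_group F\<^esub> unip b)))"
    by (subst sum.reindex) (auto simp: inj_on_def)
  also have "\<dots> = (\<Sum>a\<in>F. f (unip a) * E_act (unip a) (h (unip (b - a))))"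
    using assms by (intro sum.cong refl) (simp add: E_inv_mult)
  finally show ?thesis .
qed

lemma smash_op_add: "smash_op F (f \<oplus>\<^bsub>smash F\<^esub> h) l = smash_op F f l + smash_op F h l"
  by (simp add: smash_op_def smash_add_unip alg_op_add_left sum.distrib)

lemma smash_op_add_right: "smash_op F f (l + l') = smash_op F f l + smash_op F f l'"
  by (simp add: smash_op_def G_op_add alg_op_add_right sum.distrib)

text \<open>With \<open>b = a + c\<close> in the double sum, covariance moves \<open>G_a\<close>
  past the coefficient \<open>h(g_c)\<close>, and \<open>G_a G_c = G_(a+c)\<close>.\<close>

lemma smash_op_mult: "smash_op F (f \<otimes>\<^bsub>smash F\<^esub> h) l = smash_op F f (smash_op F h l)"
proof -
  have "smash_op F (f \<otimes>\<^bsub>smash F\<^esub> h) l = (\<Sum>b\<in>F. \<Sum>a\<in>F.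
      alg_op (f (unip a)) (alg_op (E_act (unip a) (h (unip (b - a)))) (G_op b l)))"
    unfolding smash_op_def
    by (intro sum.cong refl) (simp add: smash_mult_unip alg_op_sum_left alg_op_mult)
  also have "\<dots> = (\<Sum>a\<in>F. \<Sum>b\<in>F.
      alg_op (f (unip a)) (alg_op (E_act (unip a) (h (unip (b - a)))) (G_op b l)))"
    by (rule sum.swap)
  also have "\<dots> = (\<Sum>a\<in>F. \<Sum>c\<in>F.
      alg_op (f (unip a)) (alg_op (E_act (unip a) (h (unip c))) (G_op (a + c) l)))"
  proof (rule sum.cong[OF refl])
    fix a assume a: "a \<in> F"
    show "(\<Sum>b\<in>F. alg_op (f (unip a)) (alg_op (E_act (unip a) (h (unip (b - a)))) (G_op b l))) =
      (\<Sum>c\<in>F. alg_op (f (unip a)) (alg_op (E_act (unip a) (h (unip c))) (G_op (a + c) l)))"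
      by (rule sum.reindex_bij_witness[of _ "\<lambda>c. a + c" "\<lambda>b. b - a"])
        (use a add_F minus_F in \<open>auto simp del: add_uminus_conv_diff simp: diff_conv_add_uminus\<close>)
  qed
  also have "\<dots> = smash_op F f (smash_op F h l)"
    by (simp add: smash_op_def G_op_sum alg_op_sum_right G_op_alg_op G_op_G_op)
  finally show ?thesis .
qed

lemma smash_op_single:
  assumes "a \<in> F"
  shows "smash_op F (smash_single (E_group F) f (unip a)) l = alg_op f (G_op a l)"
proof -
  have "smash_op F (smash_single (E_group F) f (unip a)) l =
      (\<Sum>b\<in>F. if b = a then alg_op f (G_op a l) else 0)"
    unfolding smash_op_def
    by (intro sum.cong refl) (auto simp: smash_single_def E_carrier alg_op_0)
  then show ?thesis using assms finite_F by simp
qed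

lemma smash_op_of_alg: "smash_op F (of_alg F f) l = alg_op f l"
  by (simp add: of_alg_unip smash_op_single zero_F G_op_zero)

lemma smash_op_of_grp: "a \<in> F \<Longrightarrow> smash_op F (of_grp F (unip a)) l = G_op a l"
  using alg_op_const[of 1] by (simp add: of_grp_def smash_op_single free_const_1)

lemma smash_op_zero: "smash_op F \<zero>\<^bsub>smash F\<^esub> l = 0"
  using smash_op_add[of "\<zero>\<^bsub>smash F\<^esub>" "\<zero>\<^bsub>smash F\<^esub>" l]
  by (metis S.l_zero S.zero_closed add.right_neutral add_left_imp_eq)

lemma smash_op_zero_right: "smash_op F f 0 = 0"
  using smash_op_add_right[of f 0 0] by (metis add.right_neutral add_left_imp_eq)

lemma smash_op_minus:
  assumes "f \<in> carrier (smash F)" "h \<in> carrier (smash F)"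
  shows "smash_op F (f \<ominus>\<^bsub>smash F\<^esub> h) l = smash_op F f l - smash_op F h l"
proof -
  have "f = (f \<ominus>\<^bsub>smash F\<^esub> h) \<oplus>\<^bsub>smash F\<^esub> h"
    using assms S.add.inv_solve_right[of "f \<ominus>\<^bsub>smash F\<^esub> h" f h] by (simp add: S.minus_eq)
  then have "smash_op F f l = smash_op F (f \<ominus>\<^bsub>smash F\<^esub> h) l + smash_op F h l"
    by (metis smash_op_add)
  then show ?thesis by simp
qed

lemma smash_op_relation: "smash_op F (H_relation F) l = 0"
  by (simp add: H_relation_def smash_op_minus smash_op_of_alg smash_op_of_grp one_F alg_op_minus
      alg_op_mult alg_op_X alg_op_Y X_op_pCons[OF two_nonzero])

text \<open>The elements acting by zero form a two-sided ideal; it contains the relation and so the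
  ideal generated by it.\<close>

lemma smash_op_ideal:
  assumes "f \<in> H_ideal F"
  shows "smash_op F f l = 0"
proof -
  let ?K = "{f \<in> carrier (smash F). \<forall>l. smash_op F f l = 0}"
  have "ideal ?K (smash F)"
  proof (rule idealI[OF S.ring_axioms])
    show "subgroup ?K (add_monoid (smash F))"
    proof (rule S.add.subgroupI)
      fix f assume f: "f \<in> ?K"
      then have "smash_op F (\<ominus>\<^bsub>smash F\<^esub> f) l = 0" for l
        using smash_op_minus[of "\<zero>\<^bsub>smash F\<^esub>" f l] by (simp add: smash_op_zero S.minus_eq)
      then show "\<ominus>\<^bsub>smash F\<^esub> f \<in> ?K" using f by simp
    qed (auto simp: smash_op_add smash_op_zero intro: exI[of _ "\<zero>\<^bsub>smash F\<^esub>"])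
  qed (auto simp: smash_op_mult smash_op_zero_right)
  then have "H_ideal F \<subseteq> ?K"
    unfolding H_ideal_def
    by (rule S.genideal_minimal) (simp add: H_relation_closed smash_op_relation)
  then show ?thesis using assms by auto
qed

text \<open>The choice of a representative is harmless, as the ideal acts by zero.\<close>

definition poly_module :: "('k smash_elt set, 'k poly) module" where
  "poly_module = \<lparr>carrier = UNIV, monoid.mult = undefined, one = undefined, zero = 0, add = (+),
     smult = (\<lambda>C l. smash_op F (SOME f. f \<in> C) l)\<rparr>"

lemma poly_module_simps:
  "carrier poly_module = UNIV" "\<zero>\<^bsub>poly_module\<^esub> = 0" "l \<oplus>\<^bsub>poly_module\<^esub> l' = l + l'"
  by (simp_all add: poly_module_def)

lemma poly_module_smult:
  assumes "h \<in> carrier (smash F)"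
  shows "cls h \<odot>\<^bsub>poly_module\<^esub> l = smash_op F h l"
proof -
  interpret I: ideal "H_ideal F" "smash F"
    unfolding H_ideal_def using S.genideal_ideal H_relation_closed by simp
  have "(SOME f. f \<in> cls h) \<in> cls h" using I.a_rcos_self[OF assms] by (metis someI)
  then obtain i where "i \<in> H_ideal F" "(SOME f. f \<in> cls h) = i \<oplus>\<^bsub>smash F\<^esub> h"
    by (auto simp: a_r_coset_def r_coset_def)
  then show ?thesis by (simp add: poly_module_def smash_op_add smash_op_ideal)
qed

lemma poly_module_gens:
  "x_H F \<odot>\<^bsub>poly_module\<^esub> l = X_op l" "y_H F \<odot>\<^bsub>poly_module\<^esub> l = pCons 0 l"
  "a \<in> F \<Longrightarrow> grp_H F (unip a) \<odot>\<^bsub>poly_module\<^esub> l = G_op a l"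
  "const_H F c \<odot>\<^bsub>poly_module\<^esub> l = scale c l"
  by (simp_all add: x_H_def y_H_def grp_H_def const_H_def poly_module_smult smash_op_of_alg
      smash_op_of_grp alg_op_X alg_op_Y alg_op_const)

lemma poly_module_left_module: "left_module (H_alg F) poly_module"
proof (intro left_module.intro left_module_axioms.intro)
  show "ring (H_alg F)" using ring_over_field by (rule ring_over_field.axioms)
  show "abelian_group poly_module"
    by (rule abelian_groupI) (auto simp: poly_module_simps add_ac intro: exI[of _ "- l" for l])
qed (auto simp: poly_module_simps H_carrier poly_module_smult smash_op_add smash_op_add_right
    smash_op_mult smash_op_of_alg of_alg_1[symmetric] alg_op_const simp flip: cls_add cls_mult cls_one free_const_1)

end

section \<open>Modules generated by a fixed vector\<close>

locale H_module = H_setting p K F + left_module "H_alg F" M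
  for p and K :: "'k::alg_closed_field itself" and F
    and M :: "('k smash_elt set, 'm, 'd) module_scheme" (structure)

text \<open>\<open>v\<close> satisfies the relations of the generator of
  \<open>\<Delta>\<^sub>0\<close>. Instances are the class of 1 in \<open>\<Delta>\<^sub>0\<close>,
  the polynomial 1 in k[y], and a common fixed vector in a simple module over the singular
  locus.\<close>

locale cyclic_vector = H_module p K F M
  for p and K :: "'k::alg_closed_field itself" and F
    and M :: "('k smash_elt set, 'm, 'd) module_scheme" (structure) +
  fixes v
  assumes v_closed [simp, intro]: "v \<in> carrier M"
    and x_v: "x_H F \<odot>\<^bsub>M\<^esub> v = \<zero>\<^bsub>M\<^esub>"
    and grp_v: "a \<in> F \<Longrightarrow> grp_H F (unip a) \<odot>\<^bsub>M\<^esub> v = v"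
begin

interpretation HF: ring_over_field "H_alg F" "const_H F"
  by (rule ring_over_field)

text \<open>The H-linear map from the polynomial module that sends 1 to \<open>v\<close>; linearity
  is established on the generators of H below.\<close>

definition emb :: "'k poly \<Rightarrow> 'm" where
  "emb f = ring_over_field.eval (H_alg F) (const_H F) (y_H F) f \<odot>\<^bsub>M\<^esub> v"

lemma emb_closed [simp, intro]: "emb f \<in> carrier M"
  by (simp add: emb_def)

lemma emb_0 [simp]: "emb 0 = \<zero>\<^bsub>M\<^esub>"
  by (simp add: emb_def)

lemma emb_add: "emb (f + g) = emb f \<oplus>\<^bsub>M\<^esub> emb g"
  by (simp add: emb_def HF.eval_add smult_l_distr)

lemma emb_diff: "emb (f - g) = emb f \<ominus>\<^bsub>M\<^esub> emb g"
  by (simp add: emb_def HF.eval_diff smult_l_diff)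

lemma emb_mult: "emb (f * g) = HF.eval (y_H F) f \<odot>\<^bsub>M\<^esub> emb g"
  by (simp add: emb_def HF.eval_mult smult_assoc)

lemma emb_scale: "emb (scale c f) = const_H F c \<odot>\<^bsub>M\<^esub> emb f"
  by (simp add: emb_def HF.eval_scale smult_assoc)

lemma emb_pCons_0: "emb (pCons 0 f) = y_H F \<odot>\<^bsub>M\<^esub> emb f"
  by (simp add: emb_def HF.eval_pCons_0 smult_assoc)

lemma emb_1: "emb 1 = v"
  by (simp add: emb_def one_pCons HF.eval_const const_H_1)

lemma emb_const: "emb [:c:] = const_H F c \<odot>\<^bsub>M\<^esub> v"
  by (simp add: emb_def HF.eval_const)

lemma emb_pCons: "emb (pCons c f) = const_H F c \<odot>\<^bsub>M\<^esub> v \<oplus>\<^bsub>M\<^esub> y_H F \<odot>\<^bsub>M\<^esub> emb f"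
  using emb_add[of "[:c:]" "pCons 0 f"] by (simp add: emb_const emb_pCons_0)

lemma const_smult:
  "h \<in> carrier (H_alg F) \<Longrightarrow> m \<in> carrier M \<Longrightarrow>
    h \<odot>\<^bsub>M\<^esub> (const_H F c \<odot>\<^bsub>M\<^esub> m) = const_H F c \<odot>\<^bsub>M\<^esub> (h \<odot>\<^bsub>M\<^esub> m)"
  by (metis smult_assoc const_H_central generators_closed(4))

lemma x_y_smult:
  assumes "m \<in> carrier M"
  shows "x_H F \<odot>\<^bsub>M\<^esub> (y_H F \<odot>\<^bsub>M\<^esub> m) =
    y_H F \<odot>\<^bsub>M\<^esub> (x_H F \<odot>\<^bsub>M\<^esub> m) \<oplus>\<^bsub>M\<^esub> grp_H F (unip 1) \<odot>\<^bsub>M\<^esub> m"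
proof -
  have "(x_H F \<otimes>\<^bsub>H_alg F\<^esub> y_H F) \<odot>\<^bsub>M\<^esub> m =
      (y_H F \<otimes>\<^bsub>H_alg F\<^esub> x_H F \<oplus>\<^bsub>H_alg F\<^esub> grp_H F (unip 1)) \<odot>\<^bsub>M\<^esub> m"
    by (simp add: x_y)
  then show ?thesis using assms by (simp add: smult_assoc smult_l_distr)
qed

lemma grp_y_smult:
  assumes "m \<in> carrier M" "a \<in> F"
  shows "grp_H F (unip a) \<odot>\<^bsub>M\<^esub> (y_H F \<odot>\<^bsub>M\<^esub> m) =
    y_H F \<odot>\<^bsub>M\<^esub> (grp_H F (unip a) \<odot>\<^bsub>M\<^esub> m) \<oplus>\<^bsub>M\<^esub>
      const_H F a \<odot>\<^bsub>M\<^esub> (x_H F \<odot>\<^bsub>M\<^esub> (grp_H F (unip a) \<odot>\<^bsub>M\<^esub> m))"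
proof -
  have "(grp_H F (unip a) \<otimes>\<^bsub>H_alg F\<^esub> y_H F) \<odot>\<^bsub>M\<^esub> m =
     ((y_H F \<oplus>\<^bsub>H_alg F\<^esub> const_H F a \<otimes>\<^bsub>H_alg F\<^esub> x_H F) \<otimes>\<^bsub>H_alg F\<^esub> grp_H F (unip a)) \<odot>\<^bsub>M\<^esub> m"
    using assms by (simp add: grp_y)
  then show ?thesis using assms by (simp add: smult_assoc smult_l_distr)
qed

text \<open>The recursions of \<open>X\<close> and \<open>G_a\<close> on \<open>pCons\<close> mirror
  \<open>x_y_smult\<close> and \<open>grp_y_smult\<close>, and on constants both sides are fixed by
  the relations for \<open>v\<close>. Induction on a degree bound makes the hypothesis available for
  \<open>G_op a g\<close> as well.\<close>

lemma emb_ops: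
  assumes "degree f \<le> n"
  shows "emb (X_op f) = x_H F \<odot>\<^bsub>M\<^esub> emb f \<and>
    (\<forall>a\<in>F. emb (G_op a f) = grp_H F (unip a) \<odot>\<^bsub>M\<^esub> emb f)"
  using assms
proof (induction n arbitrary: f)
  case 0
  then obtain c where "f = [:c:]" by (metis degree_eq_zeroE le_zero_eq)
  then show ?case by (simp add: X_op_const G_op_const emb_const const_smult x_v grp_v)
next
  case (Suc n)
  obtain c g where f: "f = pCons c g" by (cases f) auto
  with Suc.prems have g: "degree g \<le> n" by (cases "g = 0") auto
  note IH = Suc.IH[OF g]
  have Gg: "degree (G_op a g) \<le> n" for a using degree_G_op[OF two_nonzero g] .
  have "emb (X_op f) = x_H F \<odot>\<^bsub>M\<^esub> emb f"
    using IH one_F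
    by (simp add: f X_op_pCons[OF two_nonzero] emb_add emb_pCons emb_const const_smult
        x_y_smult smult_r_distr x_v HF.const_zero)
  moreover have "emb (G_op a f) = grp_H F (unip a) \<odot>\<^bsub>M\<^esub> emb f" if "a \<in> F" for a
    using IH Suc.IH[OF Gg[of a]] that
    by (simp add: f G_op_pCons emb_add emb_pCons emb_scale emb_const const_smult grp_y_smult
        smult_r_distr grp_v M.a_assoc)
  ultimately show ?case by blast
qed

lemma emb_X_op: "emb (X_op f) = x_H F \<odot>\<^bsub>M\<^esub> emb f"
  and emb_G_op: "a \<in> F \<Longrightarrow> emb (G_op a f) = grp_H F (unip a) \<odot>\<^bsub>M\<^esub> emb f"
  using emb_ops by blast+

text \<open>Compatibility of \<open>emb\<close> with the operators gives stability under the
  generators of H, and \<open>H_induct\<close> extends it to H.\<close>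

lemma submodule_emb_image:
  assumes "0 \<in> I" and add: "\<And>f g. f \<in> I \<Longrightarrow> g \<in> I \<Longrightarrow> f + g \<in> I"
    and scale: "\<And>c f. f \<in> I \<Longrightarrow> scale c f \<in> I" and y: "\<And>f. f \<in> I \<Longrightarrow> pCons 0 f \<in> I"
    and X: "\<And>f. f \<in> I \<Longrightarrow> X_op f \<in> I" and G: "\<And>a f. a \<in> F \<Longrightarrow> f \<in> I \<Longrightarrow> G_op a f \<in> I"
  shows "submodule (emb ` I) (H_alg F) M"
proof (rule submoduleI)
  fix m m' assume "m \<in> emb ` I" "m' \<in> emb ` I"
  then show "m \<oplus>\<^bsub>M\<^esub> m' \<in> emb ` I" using add by (auto simp flip: emb_add)
next
  fix h m assume h: "h \<in> carrier (H_alg F)" and m: "m \<in> emb ` I"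
  from h have "\<forall>m\<in>emb ` I. h \<odot>\<^bsub>M\<^esub> m \<in> emb ` I"
  proof (induction h rule: H_induct)
    case (add h h')
    have "m \<oplus>\<^bsub>M\<^esub> m' \<in> emb ` I" if "m \<in> emb ` I" "m' \<in> emb ` I" for m m'
      using that assms(2) by (auto simp flip: emb_add)
    then show ?case using add by (auto simp: smult_l_distr)
  next
    case (mult h h')
    then show ?case by (auto simp: smult_assoc)
  qed (use assms in \<open>auto simp flip: emb_scale emb_pCons_0 emb_X_op emb_G_op\<close>)
  then show "h \<odot>\<^bsub>M\<^esub> m \<in> emb ` I" using m by blast
qed (use \<open>0 \<in> I\<close> in auto)

section \<open>Submodules containing the image of \<open>Q\<close>\<close>

lemma submodule_range_emb: "submodule (range emb) (H_alg F) M"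
  by (rule submodule_emb_image) auto

lemma range_emb_subset:
  assumes "submodule N (H_alg F) M" "v \<in> N"
  shows "range emb \<subseteq> N"
  using submoduleD(4)[OF assms(1) _ assms(2)] by (auto simp: emb_def)

text \<open>\<open>X\<close> and \<open>G_a\<close> commute with multiplication by \<open>Q\<close>,
  so they preserve the ideal \<open>Q k[y]\<close>.\<close>

lemma submodule_emb_Q: "submodule (emb ` range ((*) (Q \<beta>))) (H_alg F) M"
proof (rule submodule_emb_image)
  show "0 \<in> range ((*) (Q \<beta>))" by (rule range_eqI[of _ _ 0]) simp
  fix f g assume "f \<in> range ((*) (Q \<beta>))" "g \<in> range ((*) (Q \<beta>))"
  then show "f + g \<in> range ((*) (Q \<beta>))" by (auto simp flip: distrib_left)
next
  fix c f assume "f \<in> range ((*) (Q \<beta>))"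
  then obtain h where f: "f = Q \<beta> * h" by auto
  show "scale c f \<in> range ((*) (Q \<beta>))" by (rule range_eqI[of _ _ "scale c h"]) (simp add: f)
  show "pCons 0 f \<in> range ((*) (Q \<beta>))" by (rule range_eqI[of _ _ "pCons 0 h"]) (simp add: f)
  show "X_op f \<in> range ((*) (Q \<beta>))" unfolding f X_op_Q by (rule rangeI)
  show "G_op a f \<in> range ((*) (Q \<beta>))" for a unfolding f G_op_Q by (rule rangeI)
qed

lemma v_mem_if_low_degree:
  assumes N: "submodule N (H_alg F) M" and "emb f \<in> N" "f \<noteq> 0" "degree f < p"
  shows "v \<in> N"
proof -
  have "1 \<in> {f. emb f \<in> N}"
    by (rule one_mem_if_low_degree[of _ f])
      (use assms submoduleD(4)[OF N] in \<open>simp_all add: emb_scale emb_X_op\<close>)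
  then show ?thesis by (simp add: emb_1)
qed

lemma emb_mod_Q:
  "emb f = HF.eval (y_H F) (f div Q \<beta>) \<odot>\<^bsub>M\<^esub> emb (Q \<beta>) \<oplus>\<^bsub>M\<^esub> emb (f mod Q \<beta>)"
  using emb_add[of "f div Q \<beta> * Q \<beta>" "f mod Q \<beta>"] by (metis div_mult_mod_eq emb_mult)

lemma degree_mod_Q: "degree (f mod Q \<beta>) < p"
  using degree_mod_less[of "Q \<beta>" f] Q_nonzero[of \<beta>] degree_Q[of \<beta>] p_gt_2 by auto

text \<open>Division by \<open>Q\<close> keeps remainders in \<open>N\<close>, and they have degree
  below p; a nonzero one would bring \<open>v\<close> into \<open>N\<close>.\<close>

lemma submodule_with_Q_cases:
  assumes N: "submodule N (H_alg F) M" and Q: "emb (Q \<beta>) \<in> N" and sub: "N \<subseteq> range emb"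
  shows "N = emb ` range ((*) (Q \<beta>)) \<or> v \<in> N"
proof (rule disjCI)
  assume v: "v \<notin> N"
  have "emb (Q \<beta> * h) \<in> N" for h
    using submoduleD(4)[OF N _ Q] by (simp add: mult.commute[of "Q \<beta>"] emb_mult)
  moreover have "m \<in> emb ` range ((*) (Q \<beta>))" if m: "m \<in> N" for m
  proof -
    obtain f where f: "m = emb f" using m sub by auto
    have QN: "HF.eval (y_H F) (f div Q \<beta>) \<odot>\<^bsub>M\<^esub> emb (Q \<beta>) \<in> N"
      using submoduleD(4)[OF N _ Q] by simp
    have "emb (f mod Q \<beta>) = emb f \<oplus>\<^bsub>M\<^esub>
        \<ominus>\<^bsub>M\<^esub> (HF.eval (y_H F) (f div Q \<beta>) \<odot>\<^bsub>M\<^esub> emb (Q \<beta>))"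
      using emb_diff[of f "f div Q \<beta> * Q \<beta>"]
      by (simp add: emb_mult M.minus_eq minus_div_mult_eq_mod)
    also have "\<dots> \<in> N" using submoduleD(3,5)[OF N] QN m f by blast
    finally have "f mod Q \<beta> = 0" using v_mem_if_low_degree[OF N] degree_mod_Q v by blast
    then have "f = Q \<beta> * (f div Q \<beta>)" by (metis add.right_neutral mult_div_mod_eq)
    then show ?thesis using f by (metis imageI rangeI)
  qed
  ultimately show "N = emb ` range ((*) (Q \<beta>))" by blast
qed

text \<open>Turns properness of \<open>Q k[y] v\<close> into a condition on the annihilator of
  \<open>v\<close>.\<close>

lemma emb_Q_range_mem:
  "v \<in> emb ` range ((*) (Q \<beta>)) \<longleftrightarrow> (\<exists>h. emb (1 - Q \<beta> * h) = \<zero>\<^bsub>M\<^esub>)"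
proof -
  have "v = emb (Q \<beta> * h) \<longleftrightarrow> emb (1 - Q \<beta> * h) = \<zero>\<^bsub>M\<^esub>" for h
    using M.add.inv_solve_right[of "\<zero>\<^bsub>M\<^esub>" v "emb (Q \<beta> * h)"]
    by (auto simp: emb_diff emb_1 M.minus_eq)
  then show ?thesis by auto
qed

text \<open>\<open>Q\<close> has positive degree, hence is no unit, and \<open>v\<close> lies
  outside \<open>Q k[y] v\<close>; a strictly larger submodule contains \<open>v\<close> by division
  with remainder, hence everything.\<close>

lemma maximal_submodule_Q:
  assumes inj: "\<And>f. emb f = \<zero>\<^bsub>M\<^esub> \<Longrightarrow> f = 0" and surj: "carrier M \<subseteq> range emb"
  shows "maximal_submodule (H_alg F) M (submodule_generated (H_alg F) M {emb (Q \<beta>)})"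
proof -
  let ?N = "submodule_generated (H_alg F) M {emb (Q \<beta>)}"
  have N: "submodule ?N (H_alg F) M" by (rule submodule_generated_submodule) auto
  have Q: "emb (Q \<beta>) \<in> ?N" using submodule_generated_incl by blast
  have "?N \<subseteq> emb ` range ((*) (Q \<beta>))"
    by (rule submodule_generated_minimal[OF submodule_emb_Q]) (use imageI[OF rangeI[of "(*) (Q \<beta>)" 1], of emb] in simp)
  moreover have "v \<notin> emb ` range ((*) (Q \<beta>))"
  proof
    assume "v \<in> emb ` range ((*) (Q \<beta>))"
    then obtain h where "1 - Q \<beta> * h = 0" using inj emb_Q_range_mem by blast
    then have "Q \<beta> dvd 1" by (metis dvd_triv_left right_minus_eq)
    then show False using degree_Q[of \<beta>] p_gt_2 by (simp add: is_unit_iff_degree Q_nonzero)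
  qed
  ultimately have v: "v \<notin> ?N" by blast
  have max: "N' = emb ` range ((*) (Q \<beta>)) \<or> N' = carrier M"
    if N': "submodule N' (H_alg F) M" and sub: "?N \<subseteq> N'" for N'
  proof -
    have "N' = emb ` range ((*) (Q \<beta>)) \<or> v \<in> N'"
      using submodule_with_Q_cases[OF N'] sub Q submoduleD(1)[OF N'] surj by blast
    then show ?thesis using range_emb_subset[OF N'] submoduleD(1)[OF N'] surj by blast
  qed
  have "?N \<noteq> carrier M" using v by blast
  \<comment> \<open>Only one inclusion is known so far; the dichotomy applied to the generated
    submodule itself yields equality.\<close>
  then have "?N = emb ` range ((*) (Q \<beta>))" using max[OF N] by blast
  then show ?thesis
    unfolding maximal_submodule_def using N max \<open>?N \<noteq> carrier M\<close> by (metis (no_types, lifting))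
qed

section \<open>The dimension of a simple module with a fixed vector\<close>

lemma emb_sum_monom:
  "emb (\<Sum>i<n. Polynomial.monom (d i) i) =
    (\<Oplus>\<^bsub>M\<^esub>i\<in>{..<n}. const_H F (d i) \<odot>\<^bsub>M\<^esub> emb (Polynomial.monom 1 i))"
proof (induction n)
  case (Suc n)
  have m: "Polynomial.monom (d n) n = scale (d n) (Polynomial.monom 1 n)" by (simp add: smult_monom)
  have "{..<Suc n} = insert n {..<n}" by auto
  then show ?case
    by (simp add: M.finsum_insert emb_add Suc M.a_comm flip: emb_scale m)
qed simp

lemma has_dimension_p:
  assumes simple: "simple_module (H_alg F) M" and v: "v \<noteq> \<zero>\<^bsub>M\<^esub>"
  shows "has_dimension (const_H F) M p"
proof -
  have dich: "N = {\<zero>\<^bsub>M\<^esub>} \<or> N = carrier M" if "submodule N (H_alg F) M" for N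
    using simple that unfolding simple_module_def by blast
  have surj: "range emb = carrier M"
    using dich[OF submodule_range_emb] v emb_1 by (metis rangeI singletonD)
  define I where "I = {f. emb f = \<zero>\<^bsub>M\<^esub>}"
  have I_mult: "g * f \<in> I" if "f \<in> I" for f g using that by (simp add: I_def emb_mult)
  have I_diff: "f - g \<in> I" if "f \<in> I" "g \<in> I" for f g using that by (simp add: I_def emb_diff M.minus_eq)
  \<comment> \<open>A common zero of the annihilator \<open>I\<close> of \<open>v\<close>. If
    \<open>I\<close> is zero, the value 0 serves; otherwise a root of an element of least degree
    does, as that element divides all others.\<close>
  obtain y0 where y0: "\<And>f. f \<in> I \<Longrightarrow> poly f y0 = 0"
  proof (cases "I \<subseteq> {0}")
    case True
    then have "poly f 0 = 0" if "f \<in> I" for f using that by auto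
    then show ?thesis by (rule that)
  next
    case False
    define g where "g = arg_min degree (\<lambda>f. f \<in> I \<and> f \<noteq> 0)"
    obtain f0 where "f0 \<in> I \<and> f0 \<noteq> 0" using False by auto
    then have g: "g \<in> I" "g \<noteq> 0" and min: "\<And>f. f \<in> I \<Longrightarrow> f \<noteq> 0 \<Longrightarrow> degree g \<le> degree f"
      using arg_min_nat_lemma[of "\<lambda>f. f \<in> I \<and> f \<noteq> 0" f0 degree] unfolding g_def by blast+
    have "degree g \<noteq> 0"
    proof
      assume "degree g = 0"
      then obtain c where "g = [:c:]" by (rule degree_eq_zeroE)
      then have "[:1 / c:] * g = 1" using g by (simp add: one_pCons)
      then have "1 \<in> I" using I_mult[OF g(1), of "[:1 / c:]"] by simp
      then show False using v by (simp add: I_def emb_1)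
    qed
    then obtain y0 where y0: "poly g y0 = 0" using alg_closed_imp_poly_has_root[of g] by auto
    have "poly f y0 = 0" if "f \<in> I" for f
    proof -
      have "f mod g \<in> I" using I_diff[OF that I_mult[OF g(1), of "f div g"]]
        by (simp add: minus_div_mult_eq_mod)
      then have "f mod g = 0" using min degree_mod_less[of g f] g(2) by (metis leD)
      then have "f = g * (f div g)" by (metis add.right_neutral mult_div_mod_eq)
      then have "poly f y0 = poly g y0 * poly (f div g) y0" by (metis poly_mult)
      then show ?thesis using y0 by simp
    qed
    then show ?thesis by (rule that)
  qed
  \<comment> \<open>This choice makes \<open>y0\<close> a root of \<open>Q \<beta>\<close>, so every
    \<open>1 - Q \<beta> * h\<close> takes the value 1 there and lies outside
    \<open>I\<close>.\<close>
  define \<beta> where "\<beta> = poly (Q 0) y0"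
  have "poly (Q \<beta>) y0 = 0" by (subst Q_0) (simp add: \<beta>_def)
  then have "poly (1 - Q \<beta> * h) y0 \<noteq> 0" for h by simp
  then have "v \<notin> emb ` range ((*) (Q \<beta>))" using y0 emb_Q_range_mem unfolding I_def by blast
  then have "emb ` range ((*) (Q \<beta>)) = {\<zero>\<^bsub>M\<^esub>}" using dich[OF submodule_emb_Q] by blast
  then have "emb (Q \<beta> * 1) = \<zero>\<^bsub>M\<^esub>" by blast
  then have Q: "emb (Q \<beta>) = \<zero>\<^bsub>M\<^esub>" by simp
  \<comment> \<open>A nonzero annihilating polynomial of degree below p would put \<open>v\<close>
    into the zero submodule.\<close>
  have low: "f = 0" if "emb f = \<zero>\<^bsub>M\<^esub>" "degree f < p" for f
  proof (rule ccontr)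
    assume "f \<noteq> 0"
    have "submodule {\<zero>\<^bsub>M\<^esub>} (H_alg F) M" by (rule submoduleI) auto
    then show False using v_mem_if_low_degree that v \<open>f \<noteq> 0\<close> by blast
  qed
  have low_eq: "f = g" if "emb f = emb g" "degree f < p" "degree g < p" for f g
    using low[of "f - g"] that degree_diff_less[of f p g] by (simp add: emb_diff M.r_neg M.minus_eq)
  \<comment> \<open>The vectors \<open>y^i v\<close> with \<open>i < p\<close> form the basis:
    remainders modulo \<open>Q\<close> give spanning, \<open>low_eq\<close> gives
    independence.\<close>
  define b where "b i = emb (Polynomial.monom 1 i)" for i
  define P where "P d = (\<Sum>i<p. Polynomial.monom (d i) i)" for d :: "nat \<Rightarrow> 'k"
  have coeff_P: "coeff (P d) i = (if i < p then d i else 0)" for d i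
    unfolding P_def by (simp add: coeff_sum coeff_monom)
  have deg_P: "degree (P d) < p" for d
    using p_gt_2 by (intro degree_lessI) (auto simp: coeff_P)
  have b_inj: "inj_on b {..<p}"
  proof (rule inj_onI)
    fix i j assume "i \<in> {..<p}" "j \<in> {..<p}" "b i = b j"
    then have "Polynomial.monom 1 i = (Polynomial.monom 1 j :: 'k poly)"
      unfolding b_def by (intro low_eq) (auto simp: degree_monom_eq)
    then show "i = j" by (metis degree_monom_eq zero_neq_one)
  qed
  have comb: "(\<Oplus>\<^bsub>M\<^esub>m\<in>b ` {..<p}. const_H F (c m) \<odot>\<^bsub>M\<^esub> m) = emb (P (\<lambda>i. c (b i)))" for c
  proof -
    have "(\<Oplus>\<^bsub>M\<^esub>m\<in>b ` {..<p}. const_H F (c m) \<odot>\<^bsub>M\<^esub> m) =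
        (\<Oplus>\<^bsub>M\<^esub>i\<in>{..<p}. const_H F (c (b i)) \<odot>\<^bsub>M\<^esub> b i)"
      by (rule M.finsum_reindex[OF _ b_inj]) (auto simp: b_def)
    then show ?thesis unfolding P_def by (simp add: emb_sum_monom b_def)
  qed
  have "\<exists>!c. c \<in> b ` {..<p} \<rightarrow>\<^sub>E UNIV \<and> m = (\<Oplus>\<^bsub>M\<^esub>m\<in>b ` {..<p}. const_H F (c m) \<odot>\<^bsub>M\<^esub> m)"
    if m_in: "m \<in> carrier M" for m
  proof -
    obtain f where f: "m = emb f" using m_in surj by auto
    define r where "r = f mod Q \<beta>"
    have deg_r: "degree r < p" unfolding r_def by (rule degree_mod_Q)
    have m: "m = emb r" using emb_mod_Q[of f \<beta>] by (simp add: f r_def Q)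
    show ?thesis
    proof (rule ex1I)
      let ?c = "\<lambda>m\<in>b ` {..<p}. coeff r (the_inv_into {..<p} b m)"
      have "P (\<lambda>i. ?c (b i)) = r"
        using deg_r
        by (intro poly_eqI) (auto simp: coeff_P the_inv_into_f_f[OF b_inj] coeff_eq_0)
      then show "?c \<in> b ` {..<p} \<rightarrow>\<^sub>E UNIV \<and>
          m = (\<Oplus>\<^bsub>M\<^esub>m\<in>b ` {..<p}. const_H F (?c m) \<odot>\<^bsub>M\<^esub> m)"
        unfolding comb using m by simp
      fix c assume c: "c \<in> b ` {..<p} \<rightarrow>\<^sub>E UNIV \<and>
          m = (\<Oplus>\<^bsub>M\<^esub>m\<in>b ` {..<p}. const_H F (c m) \<odot>\<^bsub>M\<^esub> m)"
      then have "P (\<lambda>i. c (b i)) = r" unfolding comb using m low_eq deg_P deg_r by blast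
      then have "c (b i) = coeff r i" if "i < p" for i using coeff_P[of "\<lambda>i. c (b i)" i] that by simp
      then show "c = ?c"
        using c by (intro ext) (auto simp: the_inv_into_f_f[OF b_inj] PiE_def extensional_def)
    qed
  qed
  moreover have "card (b ` {..<p}) = p" using b_inj by (simp add: card_image)
  moreover have "b ` {..<p} \<subseteq> carrier M" by (auto simp: b_def)
  ultimately show ?thesis unfolding has_dimension_def by (intro exI[of _ "b ` {..<p}"]) auto
qed

end

section \<open>A common fixed vector from commuting nilpotent operators\<close>

text \<open>The last iterate of \<open>t\<close> on \<open>m\<close> that differs from
  \<open>z\<close> is such an element; the set cut out by \<open>P\<close> is stable under
  \<open>t\<close>.\<close>

lemma nilpotent_imp_kernel:
  assumes "P m" "m \<noteq> z" "\<And>m. P m \<Longrightarrow> P (t m)" "(t ^^ n) m = z"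
  shows "\<exists>m. P m \<and> m \<noteq> z \<and> t m = z"
  using assms(1,2,4)
proof (induction n arbitrary: m)
  case (Suc n)
  show ?case
  proof (cases "t m = z")
    case False
    then show ?thesis using Suc assms(3) by (metis comp_apply funpow_Suc_right)
  qed (use Suc in blast)
qed simp

lemma (in left_module) funpow_smult:
  assumes "a \<in> carrier R" "m \<in> carrier M"
  shows "(((\<odot>\<^bsub>M\<^esub>) a) ^^ n) m = (a [^] n) \<odot>\<^bsub>M\<^esub> m"
proof (induction n)
  case (Suc n)
  then show ?case using assms unfolding R.nat_pow_Suc2[OF assms(1)] by (simp add: smult_assoc)
qed (use assms in simp)

lemma (in left_module) finsum_smult:
  assumes "f \<in> A \<rightarrow> carrier R" "m \<in> carrier M"
  shows "(\<Oplus>\<^bsub>R\<^esub>i\<in>A. f i) \<odot>\<^bsub>M\<^esub> m = (\<Oplus>\<^bsub>M\<^esub>i\<in>A. f i \<odot>\<^bsub>M\<^esub> m)"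
  using assms(1)
proof (induction A rule: infinite_finite_induct)
  case (insert i A)
  then have "f \<in> A \<rightarrow> carrier R" "f i \<in> carrier R" by auto
  moreover from this have "(\<lambda>i. f i \<odot>\<^bsub>M\<^esub> m) \<in> A \<rightarrow> carrier M" using assms(2) by auto
  ultimately show ?case
    using insert assms(2) by (simp add: R.finsum_insert M.finsum_insert smult_l_distr)
qed (use assms(2) in simp_all)

context H_setting
begin

lemma of_nat_mult_F: "a \<in> F \<Longrightarrow> of_nat n * a \<in> F"
  by (induction n) (simp_all add: zero_F add_F distrib_right)

lemma grp_pow:
  assumes "a \<in> F"
  shows "grp_H F (unip a) [^]\<^bsub>H_alg F\<^esub> n = grp_H F (unip (of_nat n * a))"
proof -
  interpret HF: ring_over_field "H_alg F" "const_H F" by (rule ring_over_field)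
  show ?thesis
  proof (induction n)
    case (Suc n)
    then show ?case
      using assms by (simp add: grp_grp of_nat_mult_F add.commute distrib_right)
  qed (simp add: grp_0)
qed

text \<open>\<open>(T - 1)^p = T^p - 1\<close> holds in the commutative ring k[T] by Frobenius and
  is carried to H by evaluation at \<open>g_a\<close>; finally
  \<open>g_a^p = g_(p a) = 1\<close>.\<close>

lemma grp_minus_one_pow_p:
  assumes "a \<in> F"
  shows "(grp_H F (unip a) \<ominus>\<^bsub>H_alg F\<^esub> \<one>\<^bsub>H_alg F\<^esub>) [^]\<^bsub>H_alg F\<^esub> p = \<zero>\<^bsub>H_alg F\<^esub>"
proof -
  interpret HF: ring_over_field "H_alg F" "const_H F" by (rule ring_over_field)
  let ?g = "grp_H F (unip a)"
  have CH: "CHAR('k poly) = p" using CHAR_eq by simp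
  have "([:0, 1:] - 1 :: 'k poly) ^ p = [:0, 1:] ^ p + (- 1) ^ p"
    using freshmans_dream[where x = "[:0, 1:] :: 'k poly" and y = "- 1"] CH prime_p by simp
  also have "\<dots> = [:0, 1:] ^ p - 1" using odd_p by simp
  finally have e: "([:0, 1:] - 1 :: 'k poly) ^ p = [:0, 1:] ^ p - 1" .
  have one: "HF.eval ?g 1 = \<one>\<^bsub>H_alg F\<^esub>" by (simp add: one_pCons HF.eval_const const_H_1)
  have "(?g \<ominus>\<^bsub>H_alg F\<^esub> \<one>\<^bsub>H_alg F\<^esub>) [^]\<^bsub>H_alg F\<^esub> p = HF.eval ?g (([:0, 1:] - 1) ^ p)"
    by (simp only: HF.eval_pow HF.eval_diff HF.eval_X one generators_closed)
  also have "\<dots> = ?g [^]\<^bsub>H_alg F\<^esub> p \<ominus>\<^bsub>H_alg F\<^esub> \<one>\<^bsub>H_alg F\<^esub>"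
    by (simp only: e HF.eval_pow HF.eval_diff HF.eval_X one generators_closed)
  also have "\<dots> = \<zero>\<^bsub>H_alg F\<^esub>"
    using assms by (simp add: grp_pow of_nat_p grp_0 HF.minus_eq HF.r_neg)
  finally show ?thesis .
qed

end

context H_module
begin

interpretation HF: ring_over_field "H_alg F" "const_H F"
  by (rule ring_over_field)

text \<open>The operators \<open>x\<close> and \<open>g\<^sub>a - 1\<close> commute and their \<open>p\<close>-th powers vanish.\<close>

lemma exists_fixed_vector:
  assumes nonzero: "carrier M \<noteq> {\<zero>\<^bsub>M\<^esub>}" and sing: "over_singular_locus F p M"
  shows "\<exists>v \<in> carrier M. v \<noteq> \<zero>\<^bsub>M\<^esub> \<and> x_H F \<odot>\<^bsub>M\<^esub> v = \<zero>\<^bsub>M\<^esub> \<and>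
    (\<forall>a\<in>F. grp_H F (unip a) \<odot>\<^bsub>M\<^esub> v = v)"
proof -
  \<comment> \<open>The vectors killed by \<open>x\<close> and fixed by \<open>g_a\<close> for
    \<open>a\<close> in \<open>A\<close>. The induction enlarges \<open>A\<close> one element at a
    time, starting from the kernel of \<open>x\<close>.\<close>
  define P where "P A m \<longleftrightarrow> m \<in> carrier M \<and> x_H F \<odot>\<^bsub>M\<^esub> m = \<zero>\<^bsub>M\<^esub> \<and>
    (\<forall>a\<in>A. grp_H F (unip a) \<odot>\<^bsub>M\<^esub> m = m)" for A m
  have "\<exists>m. P A m \<and> m \<noteq> \<zero>\<^bsub>M\<^esub>" if "finite A" "A \<subseteq> F" for A
    using that
  proof (induction A)
    case empty
    obtain m where m: "m \<in> carrier M" "m \<noteq> \<zero>\<^bsub>M\<^esub>" using nonzero M.zero_closed by blast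
    have "((\<odot>\<^bsub>M\<^esub>) (x_H F) ^^ p) m = \<zero>\<^bsub>M\<^esub>"
      using sing m by (simp add: funpow_smult over_singular_locus_def)
    then show ?case
      using nilpotent_imp_kernel[of "\<lambda>m. m \<in> carrier M" m "\<zero>\<^bsub>M\<^esub>" "(\<odot>\<^bsub>M\<^esub>) (x_H F)" p] m
      by (auto simp: P_def)
  next
    case (insert b A)
    then obtain m where m: "P A m" "m \<noteq> \<zero>\<^bsub>M\<^esub>" by auto
    have b: "b \<in> F" and A: "A \<subseteq> F" using insert.prems by auto
    let ?w = "grp_H F (unip b) \<ominus>\<^bsub>H_alg F\<^esub> \<one>\<^bsub>H_alg F\<^esub>"
    have w: "?w \<odot>\<^bsub>M\<^esub> m = grp_H F (unip b) \<odot>\<^bsub>M\<^esub> m \<ominus>\<^bsub>M\<^esub> m" if "m \<in> carrier M" for m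
      using that by (simp add: smult_l_diff)
    \<comment> \<open>\<open>g_b - 1\<close> commutes with \<open>x\<close> and each
      \<open>g_a\<close>, so it preserves the space found so far and has a kernel inside it.\<close>
    have comm: "P A (?w \<odot>\<^bsub>M\<^esub> m)" if m: "P A m" for m
    proof -
      have c: "h \<odot>\<^bsub>M\<^esub> (?w \<odot>\<^bsub>M\<^esub> m) = ?w \<odot>\<^bsub>M\<^esub> (h \<odot>\<^bsub>M\<^esub> m)"
        if h: "h \<in> carrier (H_alg F)"
          and hb: "grp_H F (unip b) \<otimes>\<^bsub>H_alg F\<^esub> h = h \<otimes>\<^bsub>H_alg F\<^esub> grp_H F (unip b)" for h
      proof -
        have mc: "m \<in> carrier M" using m by (simp add: P_def)
        have "h \<otimes>\<^bsub>H_alg F\<^esub> ?w = ?w \<otimes>\<^bsub>H_alg F\<^esub> h"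
          using h hb by (simp add: R.minus_eq R.l_distr R.r_distr R.l_minus R.r_minus)
        then have "(h \<otimes>\<^bsub>H_alg F\<^esub> ?w) \<odot>\<^bsub>M\<^esub> m = (?w \<otimes>\<^bsub>H_alg F\<^esub> h) \<odot>\<^bsub>M\<^esub> m" by simp
        then show ?thesis using h mc by (subst (asm) (1 2) smult_assoc) auto
      qed
      have "grp_H F (unip b) \<otimes>\<^bsub>H_alg F\<^esub> grp_H F (unip a) =
          grp_H F (unip a) \<otimes>\<^bsub>H_alg F\<^esub> grp_H F (unip b)" if "a \<in> A" for a
        using that A b by (simp add: grp_grp subset_iff add.commute)
      then show ?thesis
        using m c b by (simp add: P_def grp_x)
    qed
    have "((\<odot>\<^bsub>M\<^esub>) ?w ^^ p) m = \<zero>\<^bsub>M\<^esub>"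
      using m b by (simp add: funpow_smult P_def grp_minus_one_pow_p)
    then obtain m' where m': "P A m'" "m' \<noteq> \<zero>\<^bsub>M\<^esub>" "?w \<odot>\<^bsub>M\<^esub> m' = \<zero>\<^bsub>M\<^esub>"
      using nilpotent_imp_kernel[of "P A" m "\<zero>\<^bsub>M\<^esub>" "(\<odot>\<^bsub>M\<^esub>) ?w" p] m comm by blast
    then have "grp_H F (unip b) \<odot>\<^bsub>M\<^esub> m' = m'"
      using M.add.inv_solve_right[of "\<zero>\<^bsub>M\<^esub>" "grp_H F (unip b) \<odot>\<^bsub>M\<^esub> m'" m'] w[of m']
      by (simp add: P_def M.minus_eq)
    then show ?case using m' by (auto simp: P_def)
  qed
  from this[OF finite_F] show ?thesis by (auto simp: P_def)
qed

end

section \<open>The action of \<open>Y\<close> and of the left ideal defining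
  \<open>\<Delta>\<^sub>0\<close> on \<open>v\<close>\<close>

context cyclic_vector
begin

interpretation HF: ring_over_field "H_alg F" "const_H F"
  by (rule ring_over_field)

text \<open>\<open>x^2 - 2 g_1\<close> maps \<open>v\<close> to \<open>-2 v\<close>, so its power
  contributes the scalar \<open>eps\<close>; in \<open>Y\<close> this power is the rightmost factor,
  and only \<open>y\<close> is left to act.\<close>

lemma Y_H_v: "(Y_H F p \<ominus>\<^bsub>H_alg F\<^esub> const_H F \<beta>) \<odot>\<^bsub>M\<^esub> v = emb (Q \<beta>)"
proof -
  let ?z = "x_H F [^]\<^bsub>H_alg F\<^esub> (2::nat) \<ominus>\<^bsub>H_alg F\<^esub> const_H F 2 \<otimes>\<^bsub>H_alg F\<^esub> grp_H F (unip 1)"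
  have z: "?z \<in> carrier (H_alg F)" by simp
  have "x_H F [^]\<^bsub>H_alg F\<^esub> (2::nat) \<odot>\<^bsub>M\<^esub> v = \<zero>\<^bsub>M\<^esub>"
    by (simp add: numeral_2_eq_2 smult_assoc x_v)
  moreover have "\<ominus>\<^bsub>M\<^esub> (const_H F 2 \<odot>\<^bsub>M\<^esub> v) = const_H F (- 2) \<odot>\<^bsub>M\<^esub> v"
    using emb_diff[of 0 "[:2:]"] by (simp add: emb_const M.minus_eq)
  ultimately have zv: "?z \<odot>\<^bsub>M\<^esub> v = const_H F (- 2) \<odot>\<^bsub>M\<^esub> v"
    using one_F by (simp add: smult_l_diff smult_assoc grp_v M.minus_eq)
  have zn: "?z [^]\<^bsub>H_alg F\<^esub> n \<odot>\<^bsub>M\<^esub> v = const_H F ((- 2) ^ n) \<odot>\<^bsub>M\<^esub> v" for n :: nat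
  proof (induction n)
    case (Suc n)
    have "?z [^]\<^bsub>H_alg F\<^esub> Suc n \<odot>\<^bsub>M\<^esub> v = const_H F (- 2) \<odot>\<^bsub>M\<^esub> (?z [^]\<^bsub>H_alg F\<^esub> n \<odot>\<^bsub>M\<^esub> v)"
      using z R.nat_pow_closed[OF z] by (simp only: R.nat_pow_Suc smult_assoc zv v_closed const_smult)
    then show ?case by (simp only: Suc power_Suc const_H_mult smult_assoc generators_closed v_closed)
  qed (simp add: const_H_1)
  have "y_H F [^]\<^bsub>H_alg F\<^esub> p \<odot>\<^bsub>M\<^esub> v = emb (Polynomial.monom 1 p)"
    by (simp add: emb_def monom_altdef HF.eval_pow HF.eval_X)
  moreover have "y_H F \<odot>\<^bsub>M\<^esub> (?z [^]\<^bsub>H_alg F\<^esub> ((p - 1) div 2) \<odot>\<^bsub>M\<^esub> v) = emb (scale eps [:0, 1:])"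
    unfolding zn by (simp add: emb_pCons_0 emb_const eps_def)
  ultimately show ?thesis
    using R.nat_pow_closed[OF z]
    by (simp add: Y_H_def Q_def emb_diff emb_const smult_l_diff smult_assoc del: smult_pCons)
qed

text \<open>\<open>x\<close> and every \<open>g_i - 1\<close> kill \<open>v\<close>, hence so does
  the left ideal they generate. In the polynomial module this keeps \<open>f(y)\<close> with nonzero
  \<open>f\<close> out of the ideal.\<close>

lemma Delta0_ideal_v:
  assumes "h \<in> Delta0_ideal F r \<xi>" and \<xi>: "\<And>i. \<xi> ^ i \<in> F"
  shows "h \<odot>\<^bsub>M\<^esub> v = \<zero>\<^bsub>M\<^esub>"
proof -
  let ?w = "\<lambda>i. grp_H F (g_gen \<xi> i) \<ominus>\<^bsub>H_alg F\<^esub> \<one>\<^bsub>H_alg F\<^esub>"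
  obtain k c where h: "h = (k \<otimes>\<^bsub>H_alg F\<^esub> x_H F) \<oplus>\<^bsub>H_alg F\<^esub> (\<Oplus>\<^bsub>H_alg F\<^esub>i\<in>{1..r}. c i \<otimes>\<^bsub>H_alg F\<^esub> ?w i)"
    and k: "k \<in> carrier (H_alg F)" and c: "c \<in> {1..r} \<rightarrow> carrier (H_alg F)"
    using assms(1) unfolding Delta0_ideal_def by blast
  have "?w i \<odot>\<^bsub>M\<^esub> v = \<zero>\<^bsub>M\<^esub>" for i
    using \<xi> by (simp add: smult_l_diff g_gen_def grp_v M.minus_eq M.r_neg)
  then have "(c i \<otimes>\<^bsub>H_alg F\<^esub> ?w i) \<odot>\<^bsub>M\<^esub> v = \<zero>\<^bsub>M\<^esub>" if "i \<in> {1..r}" for i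
    using c that by (simp add: smult_assoc Pi_iff)
  moreover have cw: "(\<lambda>i. c i \<otimes>\<^bsub>H_alg F\<^esub> ?w i) \<in> {1..r} \<rightarrow> carrier (H_alg F)"
    using c by auto
  ultimately have "(\<Oplus>\<^bsub>H_alg F\<^esub>i\<in>{1..r}. c i \<otimes>\<^bsub>H_alg F\<^esub> ?w i) \<odot>\<^bsub>M\<^esub> v = \<zero>\<^bsub>M\<^esub>"
    using finsum_smult[OF cw v_closed] M.finsum_cong'[of "{1..r}" "{1..r}" "\<lambda>_. \<zero>\<^bsub>M\<^esub>"]
    by simp
  then show ?thesis using k R.finsum_closed[OF cw] by (simp add: h smult_l_distr smult_assoc x_v)
qed

end

section \<open>The module $\Delta_0$\<close>

lemma (in H_setting) poly_module_cyclic_vector: "cyclic_vector p F poly_module 1"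
proof (intro cyclic_vector.intro H_module.intro H_setting_axioms poly_module_left_module
    cyclic_vector_axioms.intro)
  show "x_H F \<odot>\<^bsub>poly_module\<^esub> 1 = \<zero>\<^bsub>poly_module\<^esub>"
    using X_op_const[of 1] by (simp add: poly_module_gens poly_module_simps one_pCons)
  show "grp_H F (unip a) \<odot>\<^bsub>poly_module\<^esub> 1 = 1" if "a \<in> F" for a
    using G_op_const[of a 1] that by (simp add: poly_module_gens one_pCons)
qed (simp add: poly_module_simps)

text \<open>Generation of E by the \<open>g_i\<close> is phrased as minimality among additive
  subgroups \<open>A\<close>, ready to be applied to the set of \<open>a\<close> for which
  \<open>g_a\<close> fixes the class of 1.\<close>

locale Delta0_setting = H_setting p K F for p and K :: "'k::alg_closed_field itself" and F +
  fixes r :: nat and \<xi> :: 'k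
  assumes xi_pow_F: "\<xi> ^ i \<in> F"
    and xi_span: "\<And>A. 0 \<in> A \<Longrightarrow> (\<And>a b. a \<in> A \<Longrightarrow> b \<in> A \<Longrightarrow> a + b \<in> A) \<Longrightarrow>
      (\<And>a. a \<in> A \<Longrightarrow> - a \<in> A) \<Longrightarrow> (\<And>i. i < r \<Longrightarrow> \<xi> ^ i \<in> A) \<Longrightarrow> F \<subseteq> A"
begin

interpretation HF: ring_over_field "H_alg F" "const_H F"
  by (rule ring_over_field)

abbreviation "reg \<equiv> regular_module (H_alg F)"
abbreviation "D \<equiv> Delta0_ideal F r \<xi>"
abbreviation "w i \<equiv> grp_H F (g_gen \<xi> i) \<ominus>\<^bsub>H_alg F\<^esub> \<one>\<^bsub>H_alg F\<^esub>"

interpretation reg: left_module "H_alg F" reg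
  by (rule HF.regular_module_left_module)

lemma reg_simps:
  "carrier reg = carrier (H_alg F)" "(\<oplus>\<^bsub>reg\<^esub>) = (\<oplus>\<^bsub>H_alg F\<^esub>)" "(\<odot>\<^bsub>reg\<^esub>) = (\<otimes>\<^bsub>H_alg F\<^esub>)"
  "\<zero>\<^bsub>reg\<^esub> = \<zero>\<^bsub>H_alg F\<^esub>"
  by (simp_all add: regular_module_def)

lemma DI: "h \<in> carrier (H_alg F) \<Longrightarrow> c \<in> {1..r} \<rightarrow> carrier (H_alg F) \<Longrightarrow>
    (h \<otimes>\<^bsub>H_alg F\<^esub> x_H F) \<oplus>\<^bsub>H_alg F\<^esub> (\<Oplus>\<^bsub>H_alg F\<^esub>i\<in>{1..r}. c i \<otimes>\<^bsub>H_alg F\<^esub> w i) \<in> D"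
  unfolding Delta0_ideal_def by blast

lemma D_submodule: "submodule D (H_alg F) reg"
proof (rule reg.submoduleI)
  have closed: "(\<Oplus>\<^bsub>H_alg F\<^esub>i\<in>{1..r}. c i \<otimes>\<^bsub>H_alg F\<^esub> w i) \<in> carrier (H_alg F)"
    if "c \<in> {1..r} \<rightarrow> carrier (H_alg F)" for c
    using that by (intro HF.finsum_closed) auto
  show "D \<subseteq> carrier reg" using closed by (auto simp: Delta0_ideal_def reg_simps)
  show "D \<noteq> {}" using DI[of "\<zero>\<^bsub>H_alg F\<^esub>" "\<lambda>_. \<zero>\<^bsub>H_alg F\<^esub>"] by auto
  fix k k' assume "k \<in> D" "k' \<in> D"
  then obtain h c h' c' where k: "h \<in> carrier (H_alg F)" "c \<in> {1..r} \<rightarrow> carrier (H_alg F)"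
      "k = (h \<otimes>\<^bsub>H_alg F\<^esub> x_H F) \<oplus>\<^bsub>H_alg F\<^esub> (\<Oplus>\<^bsub>H_alg F\<^esub>i\<in>{1..r}. c i \<otimes>\<^bsub>H_alg F\<^esub> w i)"
      "h' \<in> carrier (H_alg F)" "c' \<in> {1..r} \<rightarrow> carrier (H_alg F)"
      "k' = (h' \<otimes>\<^bsub>H_alg F\<^esub> x_H F) \<oplus>\<^bsub>H_alg F\<^esub> (\<Oplus>\<^bsub>H_alg F\<^esub>i\<in>{1..r}. c' i \<otimes>\<^bsub>H_alg F\<^esub> w i)"
    unfolding Delta0_ideal_def by blast
  have cw: "(\<lambda>i. c i \<otimes>\<^bsub>H_alg F\<^esub> w i) \<in> {1..r} \<rightarrow> carrier (H_alg F)"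
      "(\<lambda>i. c' i \<otimes>\<^bsub>H_alg F\<^esub> w i) \<in> {1..r} \<rightarrow> carrier (H_alg F)"
    using k(2,5) by auto
  have "(\<Oplus>\<^bsub>H_alg F\<^esub>i\<in>{1..r}. (c i \<oplus>\<^bsub>H_alg F\<^esub> c' i) \<otimes>\<^bsub>H_alg F\<^esub> w i) =
      (\<Oplus>\<^bsub>H_alg F\<^esub>i\<in>{1..r}. c i \<otimes>\<^bsub>H_alg F\<^esub> w i \<oplus>\<^bsub>H_alg F\<^esub> c' i \<otimes>\<^bsub>H_alg F\<^esub> w i)"
    using k(2,5) by (intro HF.finsum_cong') (auto simp: Pi_iff HF.l_distr)
  also have "\<dots> = (\<Oplus>\<^bsub>H_alg F\<^esub>i\<in>{1..r}. c i \<otimes>\<^bsub>H_alg F\<^esub> w i) \<oplus>\<^bsub>H_alg F\<^esub>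
      (\<Oplus>\<^bsub>H_alg F\<^esub>i\<in>{1..r}. c' i \<otimes>\<^bsub>H_alg F\<^esub> w i)"
    by (rule HF.finsum_addf[OF cw])
  finally have "k \<oplus>\<^bsub>H_alg F\<^esub> k' = ((h \<oplus>\<^bsub>H_alg F\<^esub> h') \<otimes>\<^bsub>H_alg F\<^esub> x_H F) \<oplus>\<^bsub>H_alg F\<^esub>
      (\<Oplus>\<^bsub>H_alg F\<^esub>i\<in>{1..r}. (c i \<oplus>\<^bsub>H_alg F\<^esub> c' i) \<otimes>\<^bsub>H_alg F\<^esub> w i)"
    using k(1,4) closed[OF k(2)] closed[OF k(5)] by (simp add: k(3,6) HF.l_distr HF.a_ac)
  then show "k \<oplus>\<^bsub>reg\<^esub> k' \<in> D"
    using k(1,2,4,5) DI[of "h \<oplus>\<^bsub>H_alg F\<^esub> h'" "\<lambda>i. c i \<oplus>\<^bsub>H_alg F\<^esub> c' i"]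
    by (simp add: reg_simps Pi_iff)
next
  fix a k assume a: "a \<in> carrier (H_alg F)" and "k \<in> D"
  then obtain h c where k: "h \<in> carrier (H_alg F)" "c \<in> {1..r} \<rightarrow> carrier (H_alg F)"
      "k = (h \<otimes>\<^bsub>H_alg F\<^esub> x_H F) \<oplus>\<^bsub>H_alg F\<^esub> (\<Oplus>\<^bsub>H_alg F\<^esub>i\<in>{1..r}. c i \<otimes>\<^bsub>H_alg F\<^esub> w i)"
    unfolding Delta0_ideal_def by blast
  have cl: "(\<lambda>i. c i \<otimes>\<^bsub>H_alg F\<^esub> w i) \<in> {1..r} \<rightarrow> carrier (H_alg F)" using k(2) by auto
  have "a \<otimes>\<^bsub>H_alg F\<^esub> (\<Oplus>\<^bsub>H_alg F\<^esub>i\<in>{1..r}. c i \<otimes>\<^bsub>H_alg F\<^esub> w i) =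
      (\<Oplus>\<^bsub>H_alg F\<^esub>i\<in>{1..r}. a \<otimes>\<^bsub>H_alg F\<^esub> (c i \<otimes>\<^bsub>H_alg F\<^esub> w i))"
    using a cl by (intro HF.finsum_rdistr) auto
  also have "\<dots> = (\<Oplus>\<^bsub>H_alg F\<^esub>i\<in>{1..r}. (a \<otimes>\<^bsub>H_alg F\<^esub> c i) \<otimes>\<^bsub>H_alg F\<^esub> w i)"
    using k(2) a by (intro HF.finsum_cong') (auto simp: Pi_iff HF.m_assoc)
  finally have "a \<otimes>\<^bsub>H_alg F\<^esub> k = ((a \<otimes>\<^bsub>H_alg F\<^esub> h) \<otimes>\<^bsub>H_alg F\<^esub> x_H F) \<oplus>\<^bsub>H_alg F\<^esub>
      (\<Oplus>\<^bsub>H_alg F\<^esub>i\<in>{1..r}. (a \<otimes>\<^bsub>H_alg F\<^esub> c i) \<otimes>\<^bsub>H_alg F\<^esub> w i)"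
    using k(1) a HF.finsum_closed[OF cl] by (simp add: k(3) HF.r_distr HF.m_assoc)
  then show "a \<odot>\<^bsub>reg\<^esub> k \<in> D"
    using k(1,2) a DI[of "a \<otimes>\<^bsub>H_alg F\<^esub> h" "\<lambda>i. a \<otimes>\<^bsub>H_alg F\<^esub> c i"]
    by (simp add: reg_simps Pi_iff)
qed

lemma x_D: "x_H F \<in> D"
  using DI[of "\<one>\<^bsub>H_alg F\<^esub>" "\<lambda>_. \<zero>\<^bsub>H_alg F\<^esub>"] HF.finsum_cong'[of "{1..r}" "{1..r}" "\<lambda>_. \<zero>\<^bsub>H_alg F\<^esub>"]
  by simp

lemma w_D:
  assumes "i \<in> {1..r}"
  shows "w i \<in> D"
proof -
  let ?c = "\<lambda>j. if i = j then \<one>\<^bsub>H_alg F\<^esub> else \<zero>\<^bsub>H_alg F\<^esub>"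
  have "(\<Oplus>\<^bsub>H_alg F\<^esub>j\<in>{1..r}. ?c j \<otimes>\<^bsub>H_alg F\<^esub> w j) =
      (\<Oplus>\<^bsub>H_alg F\<^esub>j\<in>{1..r}. if i = j then w j else \<zero>\<^bsub>H_alg F\<^esub>)"
    by (intro HF.finsum_cong') auto
  also have "\<dots> = w i" using assms by (intro HF.add.finprod_singleton) auto
  finally show ?thesis using DI[of "\<zero>\<^bsub>H_alg F\<^esub>" ?c] by (simp add: Pi_iff)
qed

lemma Delta0_class_eq: "Delta0_class F r \<xi> h = D +>\<^bsub>reg\<^esub> h"
  by (simp add: Delta0_class_def a_r_coset_def r_coset_def reg_simps)

lemma Delta0_carrier: "carrier (Delta0 F r \<xi>) = Delta0_class F r \<xi> ` carrier (H_alg F)"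
  using reg.quotient_carrier[OF D_submodule] by (auto simp: Delta0_def Delta0_class_eq reg_simps)

lemma Delta0_smult:
  "h \<in> carrier (H_alg F) \<Longrightarrow> h' \<in> carrier (H_alg F) \<Longrightarrow>
    h \<odot>\<^bsub>Delta0 F r \<xi>\<^esub> Delta0_class F r \<xi> h' = Delta0_class F r \<xi> (h \<otimes>\<^bsub>H_alg F\<^esub> h')"
  using reg.quotient_smult[OF D_submodule, of h h'] by (simp add: Delta0_def Delta0_class_eq reg_simps)

lemma Delta0_zero: "\<zero>\<^bsub>Delta0 F r \<xi>\<^esub> = Delta0_class F r \<xi> \<zero>\<^bsub>H_alg F\<^esub>"
  using reg.a_coset_add_zero[OF reg.submoduleD(1)[OF D_submodule]]
  by (simp add: Delta0_def quotient_module_def Delta0_class_eq reg_simps)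

lemma Delta0_class_eq_iff:
  assumes "h \<in> carrier (H_alg F)" "h' \<in> carrier (H_alg F)"
  shows "Delta0_class F r \<xi> h = Delta0_class F r \<xi> h' \<longleftrightarrow> h \<ominus>\<^bsub>H_alg F\<^esub> h' \<in> D"
proof -
  have "h \<ominus>\<^bsub>reg\<^esub> h' = h \<ominus>\<^bsub>H_alg F\<^esub> h'"
    by (simp add: a_minus_def a_inv_def m_inv_def reg_simps)
  then show ?thesis
    using reg.quotient_eq[OF D_submodule, of h h'] assms by (simp add: Delta0_class_eq reg_simps)
qed

lemma Delta0_class_eq_zero:
  "h \<in> carrier (H_alg F) \<Longrightarrow> Delta0_class F r \<xi> h = \<zero>\<^bsub>Delta0 F r \<xi>\<^esub> \<longleftrightarrow> h \<in> D"
  by (simp add: Delta0_zero Delta0_class_eq_iff HF.minus_eq)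

lemma Delta0_left_module: "left_module (H_alg F) (Delta0 F r \<xi>)"
  unfolding Delta0_def by (rule reg.quotient_left_module[OF D_submodule])

text \<open>The ideal directly makes only the \<open>r\<close> generators fix the class of 1; the
  parameters of fixing elements form an additive subgroup, so \<open>xi_span\<close> yields all of
  E.\<close>

lemma Delta0_cyclic_vector:
  "cyclic_vector p F (Delta0 F r \<xi>) (Delta0_class F r \<xi> \<one>\<^bsub>H_alg F\<^esub>)"
proof (intro cyclic_vector.intro H_module.intro H_setting_axioms Delta0_left_module
    cyclic_vector_axioms.intro)
  let ?v = "Delta0_class F r \<xi> \<one>\<^bsub>H_alg F\<^esub>"
  interpret M: left_module "H_alg F" "Delta0 F r \<xi>" by (rule Delta0_left_module)
  show v: "?v \<in> carrier (Delta0 F r \<xi>)" by (simp add: Delta0_carrier)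
  show "x_H F \<odot>\<^bsub>Delta0 F r \<xi>\<^esub> ?v = \<zero>\<^bsub>Delta0 F r \<xi>\<^esub>"
    by (simp add: Delta0_smult Delta0_class_eq_zero x_D)
  fix a assume "a \<in> F"
  let ?A = "{a \<in> F. grp_H F (unip a) \<odot>\<^bsub>Delta0 F r \<xi>\<^esub> ?v = ?v}"
  have "F \<subseteq> ?A"
  proof (rule xi_span)
    show "0 \<in> ?A" using v by (simp add: zero_F grp_0)
    fix a b assume a: "a \<in> ?A"
    have "grp_H F (unip (a + b)) \<odot>\<^bsub>Delta0 F r \<xi>\<^esub> ?v =
        grp_H F (unip a) \<odot>\<^bsub>Delta0 F r \<xi>\<^esub> (grp_H F (unip b) \<odot>\<^bsub>Delta0 F r \<xi>\<^esub> ?v)"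
      if "b \<in> F" for b
      using a that v by (simp add: M.smult_assoc flip: grp_grp)
    then show "a + b \<in> ?A" if "b \<in> ?A" using a that by (simp add: add_F)
    have "grp_H F (unip (- a)) \<odot>\<^bsub>Delta0 F r \<xi>\<^esub> (grp_H F (unip a) \<odot>\<^bsub>Delta0 F r \<xi>\<^esub> ?v) = ?v"
    proof -
      have "grp_H F (unip (- a)) \<otimes>\<^bsub>H_alg F\<^esub> grp_H F (unip a) = \<one>\<^bsub>H_alg F\<^esub>"
        using a minus_F[of a] by (simp add: grp_grp grp_0)
      then show ?thesis using v by (metis M.smult_assoc M.smult_one generators_closed(3))
    qed
    then show "- a \<in> ?A" using a by (simp add: minus_F)
  next
    fix i assume "i < r"
    \<comment> \<open>Generators are numbered from 1, with \<open>g_gen \<xi> (Suc i)\<close> having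
      parameter \<open>\<xi> ^ i\<close>.\<close>
    then have "w (Suc i) \<in> D" by (intro w_D) auto
    then show "\<xi> ^ i \<in> ?A"
      using Delta0_class_eq_iff[of "grp_H F (unip (\<xi> ^ i))" "\<one>\<^bsub>H_alg F\<^esub>"]
      by (simp add: xi_pow_F Delta0_smult g_gen_def)
  qed
  then show "grp_H F (unip a) \<odot>\<^bsub>Delta0 F r \<xi>\<^esub> ?v = ?v" using \<open>a \<in> F\<close> by blast
qed

text \<open>\<open>\<Delta>\<^sub>0\<close> is identified with k[y]. If \<open>f(y)\<close> kills
  the class of 1, it lies in the left ideal and so kills 1 in the polynomial module, where
  \<open>f(y) 1 = f\<close>; hence \<open>f = 0\<close>. Surjectivity holds because the image is a
  submodule containing the class of 1.\<close>

lemma maximal_submodule_Delta0: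
  "maximal_submodule (H_alg F) (Delta0 F r \<xi>) (submodule_generated (H_alg F) (Delta0 F r \<xi>)
     {Delta0_class F r \<xi> (Y_H F p \<ominus>\<^bsub>H_alg F\<^esub> const_H F \<beta>)})"
proof -
  let ?v = "Delta0_class F r \<xi> \<one>\<^bsub>H_alg F\<^esub>"
  interpret C: cyclic_vector p K F "Delta0 F r \<xi>" ?v by (rule Delta0_cyclic_vector)
  interpret L: cyclic_vector p K F poly_module 1 by (rule poly_module_cyclic_vector)
  have smult_v: "h \<odot>\<^bsub>Delta0 F r \<xi>\<^esub> ?v = Delta0_class F r \<xi> h" if "h \<in> carrier (H_alg F)" for h
    using that by (simp add: Delta0_smult)
  have L: "L.emb f = f" for f
  proof (induction f)
    case (pCons c f)
    then show ?case by (simp add: L.emb_pCons poly_module_gens poly_module_simps)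
  qed (simp add: poly_module_simps)
  have inj: "f = 0" if "C.emb f = \<zero>\<^bsub>Delta0 F r \<xi>\<^esub>" for f
  proof -
    have "HF.eval (y_H F) f \<in> D"
      using that by (simp add: C.emb_def smult_v Delta0_class_eq_zero)
    then have "L.emb f = 0"
      using L.Delta0_ideal_v[OF _ xi_pow_F] by (simp add: L.emb_def poly_module_simps)
    then show ?thesis using L by simp
  qed
  have surj: "carrier (Delta0 F r \<xi>) \<subseteq> range C.emb"
  proof
    fix m assume "m \<in> carrier (Delta0 F r \<xi>)"
    then obtain h where "h \<in> carrier (H_alg F)" "m = h \<odot>\<^bsub>Delta0 F r \<xi>\<^esub> ?v"
      by (auto simp: Delta0_carrier smult_v)
    then show "m \<in> range C.emb"
      using C.submoduleD(4)[OF C.submodule_range_emb] C.emb_1 by (metis rangeI)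
  qed
  have "Y_H F p \<ominus>\<^bsub>H_alg F\<^esub> const_H F \<beta> \<in> carrier (H_alg F)"
    by (simp add: Y_H_def)
  then have "Delta0_class F r \<xi> (Y_H F p \<ominus>\<^bsub>H_alg F\<^esub> const_H F \<beta>) = C.emb (Q \<beta>)"
    using C.Y_H_v smult_v by metis
  then show ?thesis using C.maximal_submodule_Q[OF inj surj] by simp
qed

end

section \<open>Powers of a generator span the finite field additively\<close>

text \<open>If \<open>\<xi> ^ k\<close> is an integral combination of lower powers, their span is
  closed under multiplication by \<open>\<xi>\<close> and contains 1.\<close>

lemma power_span_closed:
  fixes \<xi> :: "'a::comm_ring_1"
  defines "comb k \<equiv> \<lambda>c :: nat \<Rightarrow> int. \<Sum>i<k. of_int (c i) * \<xi> ^ i"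
  assumes k: "\<xi> ^ k \<in> range (comb k)"
  shows "\<xi> ^ n \<in> range (comb k)"
proof -
  have add: "comb k c + comb k d = comb k (\<lambda>i. c i + d i)" for c d
    by (simp add: comb_def distrib_right sum.distrib)
  have of_int: "of_int e * comb k c = comb k (\<lambda>i. e * c i)" for e c
    by (simp add: comb_def sum_distrib_left mult.assoc)
  have zero: "0 = comb k (\<lambda>_. 0)" by (simp add: comb_def)
  have sum: "sum f A \<in> range (comb k)" if "\<And>i. i \<in> A \<Longrightarrow> f i \<in> range (comb k)"
    for f and A :: "nat set"
    using that
  proof (induction A rule: infinite_finite_induct)
    case (insert i A)
    then obtain c d where "f i = comb k c" "sum f A = comb k d" by (metis imageE insertCI)
    then show ?case using insert.hyps by (simp add: add)
  qed (use zero in auto)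
  have basis: "\<xi> ^ i = comb k (\<lambda>j. if j = i then 1 else 0)" if "i < k" for i
    using that by (simp add: comb_def if_distrib[of "\<lambda>x. of_int x * _"] cong: if_cong)
  have basis_Suc: "\<xi> ^ Suc i \<in> range (comb k)" if "i < k" for i
    using that k basis[of "Suc i"] by (cases "Suc i = k") auto
  have mult: "\<xi> * comb k c \<in> range (comb k)" for c
  proof -
    have "of_int (c i) * \<xi> ^ Suc i \<in> range (comb k)" if "i < k" for i
      using basis_Suc[OF that] of_int by auto
    then have "(\<Sum>i<k. of_int (c i) * \<xi> ^ Suc i) \<in> range (comb k)" by (intro sum) simp
    then show ?thesis by (simp add: comb_def sum_distrib_left mult.left_commute)
  qed
  \<comment> \<open>For \<open>k = 0\<close> the hypothesis itself places
    \<open>1 = \<xi> ^ 0\<close> in the span.\<close>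
  have "1 \<in> range (comb k)" using k basis[of 0] by (cases k) auto
  then show ?thesis by (induction n) (use mult in auto)
qed

text \<open>There are \<open>p^r\<close> combinations of \<open>\<xi> ^ i\<close>,
  \<open>i < r\<close>, with digits below p. If they are distinct, they exhaust \<open>F\<close>.
  Otherwise a coincidence expresses some \<open>\<xi> ^ k\<close> with \<open>k < r\<close> by lower
  powers, and then all powers lie in their span.\<close>

lemma (in odd_char) additive_span_powers:
  fixes F A :: "'k set" and \<xi> :: 'k
  assumes finite: "finite F" and card: "card F = p ^ r" and F: "\<And>i. \<xi> ^ i \<in> F"
    and F_zero: "0 \<in> F" and F_add: "\<And>a b. a \<in> F \<Longrightarrow> b \<in> F \<Longrightarrow> a + b \<in> F"
    and gen: "F - {0} \<subseteq> range (\<lambda>n. \<xi> ^ n)"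
    and A: "0 \<in> A" "\<And>a b. a \<in> A \<Longrightarrow> b \<in> A \<Longrightarrow> a + b \<in> A" "\<And>a. a \<in> A \<Longrightarrow> - a \<in> A"
      "\<And>i. i < r \<Longrightarrow> \<xi> ^ i \<in> A"
  shows "F \<subseteq> A"
proof -
  have of_nat_A: "of_nat n * a \<in> A" if "a \<in> A" for n a
    using that by (induction n) (simp_all add: A distrib_right)
  have of_int_A: "of_int e * a \<in> A" if "a \<in> A" for e a
    using that of_nat_A A(3) by (cases e rule: int_cases2) fastforce+
  have sum_A: "sum f B \<in> A" if "\<And>i. i \<in> B \<Longrightarrow> f i \<in> A" for f and B :: "nat set"
    using that by (induction B rule: infinite_finite_induct) (simp_all add: A)
  have of_nat_F: "of_nat n * a \<in> F" if "a \<in> F" for n a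
    using that by (induction n) (simp_all add: F_zero F_add distrib_right)
  have sum_F: "sum f B \<in> F" if "\<And>i. i \<in> B \<Longrightarrow> f i \<in> F" for f and B :: "nat set"
    using that by (induction B rule: infinite_finite_induct) (simp_all add: F_zero F_add)
  define comb where "comb c = (\<Sum>i<r. of_nat (c i) * \<xi> ^ i)" for c :: "nat \<Rightarrow> nat"
  let ?C = "{..<r} \<rightarrow>\<^sub>E {..<p}"
  have comb_A: "comb c \<in> A" for c unfolding comb_def by (intro sum_A of_nat_A A) auto
  show ?thesis
  proof (cases "inj_on comb ?C")
    case True
    have "card (comb ` ?C) = card F" using True card by (simp add: card_image card_PiE)
    moreover have "comb ` ?C \<subseteq> F" unfolding comb_def by (auto intro!: sum_F of_nat_F F)
    ultimately have "comb ` ?C = F" using finite by (intro card_subset_eq) auto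
    then show ?thesis using comb_A by auto
  next
    case False
    then obtain c d where cd: "c \<in> ?C" "d \<in> ?C" "comb c = comb d" "c \<noteq> d" unfolding inj_on_def by blast
    \<comment> \<open>The top index at which the two digit vectors differ, so that the relation can
      be solved for \<open>\<xi> ^ k\<close>.\<close>
    define k where "k = Max {i. i < r \<and> c i \<noteq> d i}"
    have "\<exists>i<r. c i \<noteq> d i" using cd by (metis PiE_ext lessThan_iff)
    then have kM: "k \<in> {i. i < r \<and> c i \<noteq> d i}" unfolding k_def by (intro Max_in) auto
    then have k: "k < r" "c k \<noteq> d k" by auto
    have above: "c i = d i" if "k < i" "i < r" for i
    proof (rule ccontr)
      assume "c i \<noteq> d i"
      then have "i \<le> k" unfolding k_def using \<open>i < r\<close> by (intro Max_ge) auto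
      then show False using \<open>k < i\<close> by simp
    qed
    let ?e = "\<lambda>i. int (c i) - int (d i)"
    have "0 = (\<Sum>i<r. of_int (?e i) * \<xi> ^ i)"
      using cd(3) by (simp add: comb_def left_diff_distrib sum_subtractf)
    also have "\<dots> = (\<Sum>i<Suc k. of_int (?e i) * \<xi> ^ i)"
      using k above by (intro sum.mono_neutral_right) auto
    finally have "of_int (?e k) * \<xi> ^ k + (\<Sum>i<k. of_int (?e i) * \<xi> ^ i) = 0"
      by (simp only: sum.lessThan_Suc add.commute)
    moreover have "(\<Sum>i<k. of_int (- ?e i) * \<xi> ^ i) = - (\<Sum>i<k. of_int (?e i) * \<xi> ^ i)"
      by (simp only: of_int_minus mult_minus_left sum_negf)
    ultimately have s: "of_int (?e k) * \<xi> ^ k = (\<Sum>i<k. of_int (- ?e i) * \<xi> ^ i)"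
      by (metis eq_neg_iff_add_eq_0)
    have "c k < p" "d k < p" using cd(1,2) k by (auto simp: PiE_iff)
    \<comment> \<open>The digits differ by less than p in absolute value, so the top coefficient is
      prime to p and a Bezout coefficient \<open>u\<close> inverts it in k.\<close>
    then have "\<not> int p dvd ?e k"
      using k(2) zdvd_imp_le[of "int p" "?e k"] zdvd_imp_le[of "int p" "- ?e k"]
      by (cases "?e k > 0") (auto simp: dvd_diff_commute)
    then have "coprime (?e k) (int p)"
      using prime_imp_coprime[of "int p" "?e k"] prime_p by (simp add: coprime_commute)
    then obtain u w where uw: "u * ?e k + w * int p = 1" using bezout_int[of "?e k" "int p"] by auto
    have "of_int u * of_int (?e k) = (1 :: 'k)"
    proof -
      have "of_int (u * ?e k + w * int p) = (1 :: 'k)" by (simp only: uw of_int_1)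
      then show ?thesis by (simp add: of_nat_p)
    qed
    then have "\<xi> ^ k = of_int u * (of_int (?e k) * \<xi> ^ k)" by (simp flip: mult.assoc)
    also have "\<dots> = (\<Sum>i<k. of_int (u * - ?e i) * \<xi> ^ i)"
      unfolding s by (simp add: sum_distrib_left mult.assoc)
    finally have "\<xi> ^ k \<in> range (\<lambda>c :: nat \<Rightarrow> int. \<Sum>i<k. of_int (c i) * \<xi> ^ i)"
      by (rule range_eqI[of _ _ "\<lambda>i. u * - ?e i"])
    then have V: "\<xi> ^ n \<in> range (\<lambda>c :: nat \<Rightarrow> int. \<Sum>i<k. of_int (c i) * \<xi> ^ i)" for n
      by (rule power_span_closed)
    have "\<xi> ^ n \<in> A" for n
    proof -
      obtain c where "\<xi> ^ n = (\<Sum>i<k. of_int (c i) * \<xi> ^ i)" using V by blast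
      also have "\<dots> \<in> A" using k A(4) by (intro sum_A of_int_A) auto
      finally show ?thesis .
    qed
    then show ?thesis using gen A(1) by blast
  qed
qed

text \<open>Translation by 1 permutes \<open>F\<close>, so the sum over \<open>F\<close> equals
  itself plus the cardinality. For \<open>p^r\<close> elements this forces characteristic p.\<close>

lemma of_nat_card_additive_group:
  fixes F :: "'a::ring_1 set"
  assumes "1 \<in> F" and "\<And>a b. a \<in> F \<Longrightarrow> b \<in> F \<Longrightarrow> a + b \<in> F" and "\<And>a. a \<in> F \<Longrightarrow> - a \<in> F"
  shows "of_nat (card F) = (0 :: 'a)"
proof -
  have "(\<Sum>a\<in>F. a + 1) = (\<Sum>a\<in>F. a)"
    by (rule sum.reindex_bij_witness[of _ "\<lambda>a. a + - 1" "\<lambda>a. a + 1"])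
      (auto intro!: assms simp del: add_uminus_conv_diff)
  then show ?thesis by (simp add: sum.distrib)
qed

theorem proposition6p14:
  fixes F :: "'k::alg_closed_field set" and \<xi> :: 'k and p r :: nat
  assumes "prime p" and "odd p" and "r > 1"
    and "closure_of_subfield F" and "finite F" and "card F = p ^ r"
    and "\<xi> \<in> F - {0}" and "F - {0} = range (\<lambda>n::nat. \<xi> ^ n)"
  shows "(\<forall>\<beta>. maximal_submodule (H_alg F) (Delta0 F r \<xi>)
            (submodule_generated (H_alg F) (Delta0 F r \<xi>)
              {Delta0_class F r \<xi> (Y_H F p \<ominus>\<^bsub>H_alg F\<^esub> const_H F \<beta>)})) \<and>
         (\<forall>M :: ('k smash_elt set, 'm) module.
            simple_module (H_alg F) M \<and> over_singular_locus F p M \<longrightarrow>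
              has_dimension (const_H F) M p)"
proof -
  have F: "0 \<in> F" "1 \<in> F" "\<And>a b. a \<in> F \<Longrightarrow> b \<in> F \<Longrightarrow> a + b \<in> F" "\<And>a. a \<in> F \<Longrightarrow> - a \<in> F"
    using assms(4) by (auto simp: closure_of_subfield_def is_subfield_def)
  have "of_nat (p ^ r) = (0 :: 'k)" using of_nat_card_additive_group[of F] F assms(6) by simp
  then have "of_nat p = (0 :: 'k)" by simp
  then have char: "odd_char TYPE('k) p" using assms by (intro odd_char.intro)
  then interpret H_setting p "TYPE('k)" F
    using F assms by (intro H_setting.intro H_setting_axioms.intro)
  have xi: "\<xi> ^ i \<in> F" for i using assms(8) by blast
  interpret Delta0_setting p "TYPE('k)" F r \<xi>
  proof (intro Delta0_setting.intro Delta0_setting_axioms.intro H_setting_axioms xi)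
    fix A :: "'k set"
    assume A: "0 \<in> A" "\<And>a b. a \<in> A \<Longrightarrow> b \<in> A \<Longrightarrow> a + b \<in> A" "\<And>a. a \<in> A \<Longrightarrow> - a \<in> A"
      "\<And>i. i < r \<Longrightarrow> \<xi> ^ i \<in> A"
    have gen: "F - {0} \<subseteq> range (\<lambda>n. \<xi> ^ n)" using assms(8) by simp
    show "F \<subseteq> A" by (rule additive_span_powers[OF assms(5,6) xi F(1,3) gen A])
  qed
  have "has_dimension (const_H F) M p"
    if simple: "simple_module (H_alg F) M" and sing: "over_singular_locus F p M"
    for M :: "('k smash_elt set, 'm) module"
  proof -
    have lm: "left_module (H_alg F) M" and nz: "carrier M \<noteq> {\<zero>\<^bsub>M\<^esub>}"
      using simple by (auto simp: simple_module_def)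
    interpret M: H_module p "TYPE('k)" F M
      by (intro H_module.intro H_setting_axioms lm)
    obtain v where v: "v \<in> carrier M" "v \<noteq> \<zero>\<^bsub>M\<^esub>" "x_H F \<odot>\<^bsub>M\<^esub> v = \<zero>\<^bsub>M\<^esub>"
        "\<forall>a\<in>F. grp_H F (unip a) \<odot>\<^bsub>M\<^esub> v = v"
      using M.exists_fixed_vector[OF nz sing] by blast
    interpret M: cyclic_vector p "TYPE('k)" F M v
      using v by (intro cyclic_vector.intro cyclic_vector_axioms.intro M.H_module_axioms) auto
    show ?thesis using simple v(2) by (rule M.has_dimension_p)
  qed
  then show ?thesis using maximal_submodule_Delta0 by blast
qed

end
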